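(* Let $X$ be a (Riemannian) manifold of dimension $d$, let $T:X\to X$ be a measurable map, and let $\mu$ be a $T$-invariant probability measure on $X$ which is absolutely continuous with continuous and strictly positive density. Suppose that $(X,T,\mu)$ has polynomial decay of correlations on Lipschitz observables with exponent $p>0$. Then for each $x_0\in X$, $$d\le\limsup_{r\to0}\frac{\log\tau_r(x,x_0)}{-\log r}\le d+\frac{2d+2}{p}$$ holds for $\mu$-almost every $x$.
   Context: $\tau_r(x,x_0)=\min\{n\ge 1: T^n(x)\in B_r(x_0)\}$ is the hitting time of the ball of radius $r$ centered at $x_0$; if it is undefined for some $r$, the upper limit above is set equal to $\infty$. A system $(X,T,\mu)$ with $\mu$ $T$-invariant has decay of correlations with power law speed with exponent $p$ (on Lipschitz observables) if there exists $\Phi(n)$ such that for all Lipschitz observables $\phi,\psi:X\to\mathbb{R}$ and all $n$, $$\left|\int \phi\circ T^n\,\psi\,d\mu-\int\phi\,d\mu\int\psi\,d\mu\right|\le\|\phi\|\,\|\psi\|\,\Phi(n),$$ and $\lim_{n\to\infty}\frac{-\log\Phi(n)}{\log n}=p$; here $\|\cdot\|$ is the Lipschitz norm (supremum norm plus Lipschitz constant). *)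

theory Defs
  imports "HOL-Probability.Probability"
begin

text \<open>
  \<open>Ck_on k S f\<close> is the usual \<open>C\<^sup>k\<close> condition on an open set \<open>S\<close> of a finite-dimensional space,
  phrased through iterated directional derivatives.
\<close>

primrec Ck_on ::
  "nat \<Rightarrow> 'e::real_normed_vector set \<Rightarrow> ('e \<Rightarrow> 'f::real_normed_vector) \<Rightarrow> bool" where
  "Ck_on 0 S f \<longleftrightarrow> continuous_on S f"
| "Ck_on (Suc k) S f \<longleftrightarrow>
     (\<forall>x\<in>S. f differentiable (at x)) \<and>
     (\<forall>v. Ck_on k S (\<lambda>x. frechet_derivative f (at x) v))"

definition smooth_on ::
  "'e::real_normed_vector set \<Rightarrow> ('e \<Rightarrow> 'f::real_normed_vector) \<Rightarrow> bool" where
  "smooth_on S f \<longleftrightarrow> (\<forall>k. Ck_on k S f)"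

text \<open>
  A chart is a pair \<open>(U, \<phi>)\<close>; the values of \<open>\<phi>\<close> outside \<open>U\<close> are irrelevant. The manifold is the
  whole type \<open>'a\<close>, its dimension is \<open>CARD('n)\<close>.
\<close>

type_synonym ('a, 'n) chart = "'a set \<times> ('a \<Rightarrow> real ^ 'n)"

definition smooth_atlas :: "('a::topological_space, 'n::finite) chart set \<Rightarrow> bool" where
  "smooth_atlas A \<longleftrightarrow>
     (\<forall>(U, \<phi>)\<in>A. open U \<and> open (\<phi> ` U) \<and> homeomorphism U (\<phi> ` U) \<phi> (inv_into U \<phi>)) \<and>
     (\<Union>(U, \<phi>)\<in>A. U) = UNIV \<and>
     (\<forall>(U, \<phi>)\<in>A. \<forall>(V, \<psi>)\<in>A. smooth_on (\<phi> ` (U \<inter> V)) (\<psi> \<circ> inv_into U \<phi>))"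

text \<open>
  A Riemannian metric tensor is given by its coordinate matrices: \<open>g c x\<close> is the Gram matrix at
  the point \<open>x\<close> of the coordinate vector fields of the chart \<open>c\<close>. The last clause is the
  transformation law of a covariant 2-tensor.
\<close>

definition riemannian_metric ::
  "('a::topological_space, 'n::finite) chart set \<Rightarrow>
   (('a, 'n) chart \<Rightarrow> 'a \<Rightarrow> real ^ 'n ^ 'n) \<Rightarrow> bool" where
  "riemannian_metric A g \<longleftrightarrow>
     (\<forall>(U, \<phi>)\<in>A.
        smooth_on (\<phi> ` U) (\<lambda>q. g (U, \<phi>) (inv_into U \<phi> q)) \<and>
        (\<forall>x\<in>U. transpose (g (U, \<phi>) x) = g (U, \<phi>) x \<and>
                (\<forall>v. v \<noteq> 0 \<longrightarrow> 0 < v \<bullet> (g (U, \<phi>) x *v v)))) \<and>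
     (\<forall>(U, \<phi>)\<in>A. \<forall>(V, \<psi>)\<in>A. \<forall>x\<in>U \<inter> V.
        let J = matrix (frechet_derivative (\<psi> \<circ> inv_into U \<phi>) (at (\<phi> x)))
        in g (U, \<phi>) x = transpose J ** g (V, \<psi>) x ** J)"

definition piecewise_C1_curve ::
  "('a::topological_space, 'n::finite) chart set \<Rightarrow> (real \<Rightarrow> 'a) \<Rightarrow> bool" where
  "piecewise_C1_curve A \<gamma> \<longleftrightarrow>
     path \<gamma> \<and>
     (\<forall>(U, \<phi>)\<in>A. \<forall>a b. {a..b} \<subseteq> {0..1} \<and> \<gamma> ` {a..b} \<subseteq> U \<longrightarrow>
        (\<phi> \<circ> \<gamma>) piecewise_C1_differentiable_on {a..b})"

text \<open>
  By the transformation law the speed does not depend on the chart chosen, except at the finitely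
  many parameters where the curve is not differentiable.
\<close>

definition curve_speed ::
  "('a::topological_space, 'n::finite) chart set \<Rightarrow>
   (('a, 'n) chart \<Rightarrow> 'a \<Rightarrow> real ^ 'n ^ 'n) \<Rightarrow> (real \<Rightarrow> 'a) \<Rightarrow> real \<Rightarrow> real" where
  "curve_speed A g \<gamma> t =
     (let c = (SOME c. c \<in> A \<and> \<gamma> t \<in> fst c);
          v = vector_derivative (snd c \<circ> \<gamma>) (at t)
      in sqrt (v \<bullet> (g c (\<gamma> t) *v v)))"

text \<open>
  The length is extended-valued because \<open>piecewise_C1_differentiable_on\<close> allows the derivative to
  be unbounded near a break point.
\<close>

definition curve_length ::
  "('a::topological_space, 'n::finite) chart set \<Rightarrow>
   (('a, 'n) chart \<Rightarrow> 'a \<Rightarrow> real ^ 'n ^ 'n) \<Rightarrow> (real \<Rightarrow> 'a) \<Rightarrow> ennreal" where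
  "curve_length A g \<gamma> = (\<integral>\<^sup>+t\<in>{0..1}. ennreal (curve_speed A g \<gamma> t) \<partial>lborel)"

definition curves_between ::
  "('a::topological_space, 'n::finite) chart set \<Rightarrow> 'a \<Rightarrow> 'a \<Rightarrow> (real \<Rightarrow> 'a) set" where
  "curves_between A x y =
     {\<gamma>. piecewise_C1_curve A \<gamma> \<and> pathstart \<gamma> = x \<and> pathfinish \<gamma> = y}"

text \<open>
  The distance of the type is the Riemannian distance. On a connected manifold any two points are
  joined by a curve, so \<open>dist\<close> is completely determined; connectedness is not required, and
  the distance between points of different components is left open.
\<close>

definition riemannian_manifold ::
  "('a::{metric_space, second_countable_topology}, 'n::finite) chart set \<Rightarrow>
   (('a, 'n) chart \<Rightarrow> 'a \<Rightarrow> real ^ 'n ^ 'n) \<Rightarrow> bool" where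
  "riemannian_manifold A g \<longleftrightarrow>
     smooth_atlas A \<and> riemannian_metric A g \<and>
     (\<forall>x y. curves_between A x y \<noteq> {} \<longrightarrow>
        ennreal (dist x y) = (INF \<gamma>\<in>curves_between A x y. curve_length A g \<gamma>))"

text \<open>
  The Riemannian volume is the unique Borel measure that is \<open>sqrt (det g)\<close> times Lebesgue measure
  in each chart.
\<close>

definition is_riemannian_volume ::
  "('a::topological_space, 'n::finite) chart set \<Rightarrow>
   (('a, 'n) chart \<Rightarrow> 'a \<Rightarrow> real ^ 'n ^ 'n) \<Rightarrow> 'a measure \<Rightarrow> bool" where
  "is_riemannian_volume A g vol \<longleftrightarrow>
     sets vol = sets borel \<and>
     (\<forall>(U, \<phi>)\<in>A. \<forall>B\<in>sets borel. B \<subseteq> U \<longrightarrow>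
        emeasure vol B =
          (\<integral>\<^sup>+q\<in>\<phi> ` B. ennreal (sqrt (det (g (U, \<phi>) (inv_into U \<phi> q)))) \<partial>lborel))"

text \<open>
  Observables are taken bounded, so that the Lipschitz norm is finite (automatic if \<open>'a\<close> is
  compact).
\<close>

definition lipschitz_observable :: "('a::metric_space \<Rightarrow> real) \<Rightarrow> bool" where
  "lipschitz_observable f \<longleftrightarrow> bounded (range f) \<and> (\<exists>L. L-lipschitz_on UNIV f)"

definition lipschitz_norm :: "('a::metric_space \<Rightarrow> real) \<Rightarrow> real" where
  "lipschitz_norm f = (SUP x. \<bar>f x\<bar>) + Inf {L. L-lipschitz_on UNIV f}"

text \<open>
  \<open>\<Phi>\<close> is automatically nonnegative (constant observables), and for \<open>p > 0\<close> the limit forces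
  \<open>\<Phi> n > 0\<close> for large \<open>n\<close>, because \<open>ln 0 = 0\<close>.
\<close>

definition power_law_decay ::
  "'a::metric_space measure \<Rightarrow> ('a \<Rightarrow> 'a) \<Rightarrow> real \<Rightarrow> bool" where
  "power_law_decay M T p \<longleftrightarrow>
     (\<exists>\<Phi>::nat \<Rightarrow> real.
        (\<forall>f h n. lipschitz_observable f \<and> lipschitz_observable h \<longrightarrow>
           \<bar>(\<integral>x. f ((T ^^ n) x) * h x \<partial>M) - (\<integral>x. f x \<partial>M) * (\<integral>x. h x \<partial>M)\<bar>
             \<le> lipschitz_norm f * lipschitz_norm h * \<Phi> n) \<and>
        (\<lambda>n. - ln (\<Phi> n) / ln (real n)) \<longlonglongrightarrow> p)"

definition hitting_time :: "('a::metric_space \<Rightarrow> 'a) \<Rightarrow> real \<Rightarrow> 'a \<Rightarrow> 'a \<Rightarrow> nat" where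
  "hitting_time T r x x0 = (LEAST n. 1 \<le> n \<and> (T ^^ n) x \<in> ball x0 r)"

definition upper_hitting_exponent :: "('a::metric_space \<Rightarrow> 'a) \<Rightarrow> 'a \<Rightarrow> 'a \<Rightarrow> ereal" where
  "upper_hitting_exponent T x x0 =
     (if \<forall>r>0. \<exists>n\<ge>1. (T ^^ n) x \<in> ball x0 r
      then Limsup (at_right 0) (\<lambda>r. ereal (ln (real (hitting_time T r x x0)) / - ln r))
      else \<infinity>)"

end

theory Submission imports Defs begin

text \<open>
  Two facts carry the theorem: the measure of a small ball is comparable to \<open>r ^ d\<close>, where \<open>d\<close> is
  the dimension, and a power law for correlations makes the orbit find such a ball after roughly
  \<open>1 / measure\<close> visits, provided that the visits are spaced widely enough to be almost independent.

  \<^emph>\<open>Ball measures\<close> (\<open>riemannian_volume_ball_bounds\<close>). In a small closed coordinate ball around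
  \<open>x0\<close> the coordinate matrices of the metric form a compact family of positive definite matrices, so
  Riemannian speed and Euclidean coordinate speed agree up to constants. A coordinate segment is a
  competitor for the distance, which bounds it above by a multiple of the coordinate distance. Every
  curve from \<open>x0\<close> to a point at small coordinate distance \<open>s\<close> travels the coordinate distance \<open>s\<close>
  while it is still inside the chart, even if it leaves the chart later on, which bounds the distance
  below. So metric balls are sandwiched between coordinate balls whose radii are multiples of \<open>r\<close>, and the volume density
  \<open>sqrt (det g)\<close> and the density of the measure are bounded away from \<open>0\<close> and \<open>\<infinity>\<close> there.

  \<^emph>\<open>Lower bound\<close> (\<open>AE_eventually_not_hit_early\<close>). By invariance, the probability of hitting a ball
  of radius \<open>r\<close> within \<open>N\<close> steps is at most \<open>N\<close> times its measure, hence \<open>O(r powr \<epsilon>)\<close> for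
  \<open>N \<le> r powr - (d - \<epsilon>)\<close>. Along \<open>r = 2 powr - k\<close> this is summable, and the Borel-Cantelli lemma applies.

  \<^emph>\<open>Upper bound\<close> (\<open>AE_eventually_hit_soon\<close>). Let \<open>f\<close> be a Lipschitz cut-off of the ball, with norm
  \<open>O(1 / r)\<close> and integral \<open>m \<ge> c * r ^ d\<close>. Observe \<open>f\<close> only at the times \<open>g, 2 * g, \<dots>, K * g\<close>. The
  variance of the sum is at most \<open>K * m\<close> from the diagonal plus
  \<open>K\<^sup>2 * O(r powr - 2) * g powr - q\<close> from the other pairs, where \<open>q < p\<close>. By Chebyshev's inequality all
  these visits miss the ball with probability at most
  \<open>1 / (K * m) + O(r powr - (2 * d + 2)) * g powr - q\<close>. The first term is \<open>O(r powr \<epsilon>)\<close> for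
  \<open>K = r powr - (d + \<epsilon>)\<close>. The second one is a positive power of \<open>r\<close> for
  \<open>g = r powr - ((2 * d + 2) / p + \<epsilon>)\<close> and \<open>q\<close> close to \<open>p\<close>. Thus, by Borel-Cantelli again, the
  ball is hit no later than time \<open>K * g\<close>, which up to \<open>\<epsilon>\<close> is \<open>1 / r\<close> to the power
  \<open>d + (2 * d + 2) / p\<close>. With all times up to \<open>N\<close> instead of a sparse set, the bounds on the
  correlations of close times alone would amount to \<open>O(r powr - (2 * d + 2)) / N\<close>, which is too much when \<open>p\<close> is
  large; this is the reason for the gaps.
\<close>

section \<open>Bounds for families of positive definite matrices\<close>

text \<open>
  The segment from the identity matrix to \<open>G\<close> consists of positive definite, hence invertible,
  matrices, so the determinant does not change its sign along it.
\<close>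

lemma positive_definite_det_pos:
  fixes G :: "real ^ 'n ^ 'n"
  assumes pos: "\<And>v. v \<noteq> 0 \<Longrightarrow> 0 < v \<bullet> (G *v v)"
  shows "0 < det G"
proof (rule ccontr)
  assume neg: "\<not> 0 < det G"
  define H where "H t = (1 - t) *\<^sub>R mat 1 + t *\<^sub>R G" for t :: real
  have cont: "continuous_on {0..1} (\<lambda>t. det (H t))"
    unfolding det_def H_def by (intro continuous_intros)
  have "\<exists>t\<ge>0. t \<le> 1 \<and> det (H t) = 0"
    using IVT2'[of "\<lambda>t. det (H t)" 1 0 0, OF _ _ _ cont] neg by (simp add: H_def)
  then obtain t where t: "0 \<le> t" "t \<le> 1" "det (H t) = 0" by blast
  then have "\<not> invertible (H t)" by (simp add: invertible_det_nz)
  then obtain v where v: "H t *v v = 0" "v \<noteq> 0"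
    using matrix_left_invertible_ker[of "H t"] invertible_left_inverse[of "H t"] by blast
  have "v \<bullet> (H t *v v) = (1 - t) * (v \<bullet> v) + t * (v \<bullet> (G *v v))"
    unfolding H_def
    by (simp add: matrix_vector_mult_add_rdistrib scaleR_matrix_vector_assoc[symmetric] inner_add_right)
  moreover have "0 < v \<bullet> v" "0 < v \<bullet> (G *v v)" using v pos by auto
  then have "0 < (1 - t) * (v \<bullet> v) + t * (v \<bullet> (G *v v))"
    using t by (cases "t = 0") (auto intro: add_nonneg_pos)
  ultimately show False using v by simp
qed

lemma continuous_on_quadratic_form:
  fixes G :: "'b::topological_space \<Rightarrow> real ^ 'n ^ 'n"
  assumes "continuous_on S G" "continuous_on S v"
  shows "continuous_on S (\<lambda>x. v x \<bullet> (G x *v v x))"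
  unfolding inner_vec_def matrix_vector_mult_def
  using assms by (auto intro!: continuous_intros)

text \<open>
  A quadratic form is determined by its values on the unit sphere, so compactness of the parameter set
  times the sphere gives constants for all vectors at once. A single pair of constants also serves
  for the volume densities \<open>sqrt (det (G q))\<close>.
\<close>

lemma positive_definite_family_bounds:
  fixes G :: "'b::topological_space \<Rightarrow> real ^ 'n ^ 'n"
  assumes K: "compact K" and cont: "continuous_on K G"
    and pos: "\<And>q v. q \<in> K \<Longrightarrow> v \<noteq> 0 \<Longrightarrow> 0 < v \<bullet> (G q *v v)"
  obtains c C where "0 < c" "0 < C"
    "\<And>q v. q \<in> K \<Longrightarrow> c * norm v \<le> sqrt (v \<bullet> (G q *v v))"
    "\<And>q v. q \<in> K \<Longrightarrow> sqrt (v \<bullet> (G q *v v)) \<le> C * norm v"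
    "\<And>q. q \<in> K \<Longrightarrow> c \<le> sqrt (det (G q))"
    "\<And>q. q \<in> K \<Longrightarrow> sqrt (det (G q)) \<le> C"
proof (cases "K = {}")
  case True
  then show ?thesis using that[of 1 1] by auto
next
  case False
  define Q where "Q = (\<lambda>(q, v). sqrt (v \<bullet> (G q *v v)))"
  define P where "P = K \<times> sphere (0 :: real ^ 'n) 1"
  have P: "compact P" "P \<noteq> {}"
    using False K by (auto simp: P_def intro!: compact_Times)
  have "continuous_on P (\<lambda>z. G (fst z))"
    by (rule continuous_on_compose2[OF cont]) (auto simp: P_def intro!: continuous_intros)
  then have contQ: "continuous_on P Q"
    unfolding Q_def case_prod_unfold
    by (intro continuous_intros continuous_on_quadratic_form)
  have contD: "continuous_on K (\<lambda>q. sqrt (det (G q)))"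
    unfolding det_def using cont by (intro continuous_intros) auto
  obtain z1 where z1: "z1 \<in> P" "\<And>z. z \<in> P \<Longrightarrow> Q z1 \<le> Q z"
    using continuous_attains_inf[OF P contQ] by blast
  obtain z2 where z2: "z2 \<in> P" "\<And>z. z \<in> P \<Longrightarrow> Q z \<le> Q z2"
    using continuous_attains_sup[OF P contQ] by blast
  obtain q1 where q1: "q1 \<in> K" "\<And>q. q \<in> K \<Longrightarrow> sqrt (det (G q1)) \<le> sqrt (det (G q))"
    using continuous_attains_inf[OF K False contD] by blast
  obtain q2 where q2: "q2 \<in> K" "\<And>q. q \<in> K \<Longrightarrow> sqrt (det (G q)) \<le> sqrt (det (G q2))"
    using continuous_attains_sup[OF K False contD] by blast
  have Qpos: "0 < Q z" if "z \<in> P" for z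
    using that pos[of "fst z" "snd z"] by (cases "snd z = 0") (auto simp: P_def Q_def)
  have Dpos: "0 < sqrt (det (G q))" if "q \<in> K" for q
    using positive_definite_det_pos[of "G q"] pos that by simp
  have hom: "sqrt (v \<bullet> (G q *v v)) = norm v * Q (q, v /\<^sub>R norm v)" if "v \<noteq> 0" for q v
  proof -
    have "v \<bullet> (G q *v v) = (norm v)\<^sup>2 * ((v /\<^sub>R norm v) \<bullet> (G q *v (v /\<^sub>R norm v)))"
      using that by (simp add: matrix_vector_mult_scaleR power2_eq_square field_simps)
    then show ?thesis
      by (simp add: Q_def real_sqrt_mult)
  qed
  have inP: "(q, v /\<^sub>R norm v) \<in> P" if "q \<in> K" "v \<noteq> 0" for q v
    using that by (simp add: P_def)
  define c where "c = min (Q z1) (sqrt (det (G q1)))"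
  define C where "C = max (Q z2) (sqrt (det (G q2)))"
  show ?thesis
  proof (rule that[of c C])
    show "0 < c" "0 < C"
      using Qpos[OF z1(1)] Qpos[OF z2(1)] Dpos[OF q1(1)] by (auto simp: c_def C_def)
    fix q :: 'b and v :: "real ^ 'n"
    assume q: "q \<in> K"
    show "c \<le> sqrt (det (G q))" "sqrt (det (G q)) \<le> C"
      using q1(2)[OF q] q2(2)[OF q] unfolding c_def C_def
      by (meson min.coboundedI2 max.coboundedI2)+
    have *: "c * norm v \<le> sqrt (v \<bullet> (G q *v v)) \<and> sqrt (v \<bullet> (G q *v v)) \<le> C * norm v"
    proof (cases "v = 0")
      case v: False
      have "c \<le> Q (q, v /\<^sub>R norm v)" "Q (q, v /\<^sub>R norm v) \<le> C"
        using z1(2)[OF inP[OF q v]] z2(2)[OF inP[OF q v]] by (auto simp: c_def C_def)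
      then show ?thesis unfolding hom[OF v]
        by (auto simp: mult.commute[of _ "norm v"] intro: mult_left_mono)
    qed simp
    then show "c * norm v \<le> sqrt (v \<bullet> (G q *v v))" "sqrt (v \<bullet> (G q *v v)) \<le> C * norm v"
      by auto
  qed
qed

section \<open>Riemannian length in a chart\<close>

lemma smooth_on_derivative_rules:
  assumes "smooth_on S f"
  shows smooth_on_imp_differentiable: "x \<in> S \<Longrightarrow> f differentiable (at x)"
    and smooth_on_imp_continuous_on: "continuous_on S f"
    and smooth_on_imp_continuous_derivative:
      "continuous_on S (\<lambda>x. frechet_derivative f (at x) v)"
proof -
  have "Ck_on 0 S f" "Ck_on (Suc 0) S f"
    using assms unfolding smooth_on_def by blast+
  then show "x \<in> S \<Longrightarrow> f differentiable (at x)" "continuous_on S f"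
    "continuous_on S (\<lambda>x. frechet_derivative f (at x) v)"
    by auto
qed

lemma chart_rules:
  assumes "smooth_atlas A" "(U, \<phi>) \<in> A"
  shows chart_open: "open U" and chart_image_open: "open (\<phi> ` U)"
    and chart_cont: "continuous_on U \<phi>"
    and chart_inv_cont: "continuous_on (\<phi> ` U) (inv_into U \<phi>)"
    and chart_inv: "x \<in> U \<Longrightarrow> inv_into U \<phi> (\<phi> x) = x"
proof -
  have "open U \<and> open (\<phi> ` U) \<and> homeomorphism U (\<phi> ` U) \<phi> (inv_into U \<phi>)"
    using assms unfolding smooth_atlas_def by blast
  then show "open U" "open (\<phi> ` U)" "continuous_on U \<phi>" "continuous_on (\<phi> ` U) (inv_into U \<phi>)"
    and "x \<in> U \<Longrightarrow> inv_into U \<phi> (\<phi> x) = x"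
    by (auto simp: homeomorphism_def)
qed

text \<open>
  The speed of a curve is defined with an arbitrarily chosen chart. The transformation law of the metric
  tensor cancels the Jacobian of the change of charts, so any other chart gives the same value.
\<close>

lemma curve_speed_in_chart:
  fixes A :: "('a::metric_space, 'n::finite) chart set"
  assumes A: "smooth_atlas A" and g: "riemannian_metric A g"
    and c: "(U, \<phi>) \<in> A" and cont: "isCont \<gamma> t" and U: "\<gamma> t \<in> U"
    and w: "((\<phi> \<circ> \<gamma>) has_vector_derivative w) (at t)"
  shows "curve_speed A g \<gamma> t = sqrt (w \<bullet> (g (U, \<phi>) (\<gamma> t) *v w))"
proof -
  define c' where "c' = (SOME c. c \<in> A \<and> \<gamma> t \<in> fst c)"
  have "\<exists>c. c \<in> A \<and> \<gamma> t \<in> fst c" using c U by force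
  then have c': "c' \<in> A \<and> \<gamma> t \<in> fst c'" unfolding c'_def by (rule someI_ex)
  obtain V \<psi> where V: "c' = (V, \<psi>)" by force
  then have V': "(V, \<psi>) \<in> A" "\<gamma> t \<in> V" using c' by auto
  define F where "F = \<psi> \<circ> inv_into U \<phi>"
  define J where "J = frechet_derivative F (at (\<phi> (\<gamma> t)))"
  have "smooth_on (\<phi> ` (U \<inter> V)) F"
    using A c V' unfolding smooth_atlas_def F_def by blast
  then have "F differentiable (at (\<phi> (\<gamma> t)))"
    by (rule smooth_on_imp_differentiable) (use U V' in auto)
  then have J: "(F has_derivative J) (at (\<phi> (\<gamma> t)))"
    unfolding J_def by (rule frechet_derivative_works[THEN iffD1])
  then have lin: "linear J" by (rule has_derivative_linear)
  have "(\<phi> \<circ> \<gamma> has_derivative (\<lambda>s. s *\<^sub>R w)) (at t)"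
    using w by (simp add: has_vector_derivative_def)
  from diff_chain_at[OF this] J
  have "(F \<circ> (\<phi> \<circ> \<gamma>) has_derivative J \<circ> (\<lambda>s. s *\<^sub>R w)) (at t)"
    by simp
  then have "(F \<circ> (\<phi> \<circ> \<gamma>) has_vector_derivative J w) (at t)"
    by (simp add: has_vector_derivative_def o_def linear_scale[OF lin])
  moreover have "open (U \<inter> V)"
    using chart_open[OF A c] chart_open[OF A V'(1)] by auto
  have ev: "eventually (\<lambda>s. \<gamma> s \<in> U \<inter> V) (nhds t)"
    by (rule topological_tendstoD[OF cont[unfolded isCont_def tendsto_at_iff_tendsto_nhds]])
      (use \<open>open (U \<inter> V)\<close> U V' in auto)
  then have "eventually (\<lambda>s. (F \<circ> (\<phi> \<circ> \<gamma>)) s = (\<psi> \<circ> \<gamma>) s) (nhds t)"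
    by eventually_elim (simp add: F_def chart_inv[OF A c])
  then obtain W where W: "open W" "t \<in> W" "\<And>s. s \<in> W \<Longrightarrow> (F \<circ> (\<phi> \<circ> \<gamma>)) s = (\<psi> \<circ> \<gamma>) s"
    unfolding eventually_nhds by blast
  ultimately have "(\<psi> \<circ> \<gamma> has_vector_derivative J w) (at t)"
    using has_vector_derivative_transform_within_open[OF _ W(1,2), of "F \<circ> (\<phi> \<circ> \<gamma>)" _ "\<psi> \<circ> \<gamma>"] W(3) by blast
  then have vd: "vector_derivative (\<psi> \<circ> \<gamma>) (at t) = J w"
    by (rule vector_derivative_at)
  have mat: "J w = matrix J *v w" using lin by (simp add: matrix_vector_mul(1)[symmetric])
  have "g (U, \<phi>) (\<gamma> t) = transpose (matrix J) ** g (V, \<psi>) (\<gamma> t) ** matrix J"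
    using g c V' U unfolding riemannian_metric_def J_def F_def Let_def by blast
  then have "w \<bullet> (g (U, \<phi>) (\<gamma> t) *v w) = J w \<bullet> (g (V, \<psi>) (\<gamma> t) *v J w)"
    unfolding mat
    by (simp add: matrix_vector_mul_assoc[symmetric] inner_commute[of w] dot_lmul_matrix)
      (simp add: inner_commute)
  then show ?thesis
    unfolding curve_speed_def c'_def[symmetric] V Let_def by (simp add: vd)
qed

text \<open>
  The fundamental theorem of calculus, followed by the triangle inequality for integrals. The
  derivative of a piecewise \<open>C\<^sup>1\<close> function need not be Lebesgue integrable near the break points; in
  that case the right-hand side is infinite. The bound \<open>h\<close> is allowed to be non-measurable because
  the speed of a curve depends on a choice of charts.
\<close>

lemma norm_increment_le_nn_integral:
  fixes f :: "real \<Rightarrow> 'b::euclidean_space"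
  assumes f: "f piecewise_C1_differentiable_on {a..b}" and "a \<le> b" and "0 \<le> c"
    and h: "\<And>t w. t \<in> {a<..<b} \<Longrightarrow> (f has_vector_derivative w) (at t) \<Longrightarrow> ennreal (c * norm w) \<le> h t"
  shows "ennreal (c * norm (f b - f a)) \<le> (\<integral>\<^sup>+t\<in>{a..b}. h t \<partial>lborel)"
proof -
  obtain S where S: "finite S" "f C1_differentiable_on ({a..b} - S)" and contf: "continuous_on {a..b} f"
    using f unfolding piecewise_C1_differentiable_on_def by blast
  then obtain D where D: "\<And>t. t \<in> {a..b} - S \<Longrightarrow> (f has_vector_derivative D t) (at t)"
      and contD: "continuous_on ({a..b} - S) D"
    unfolding C1_differentiable_on_def by blast
  define E where "E t = indicator ({a..b} - S) t *\<^sub>R D t" for t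
  have bS: "{a..b} - S \<in> sets borel" using S(1) by (simp add: borel_closed finite_imp_closed sets.Diff)
  have Em: "E \<in> borel_measurable borel"
    unfolding E_def by (rule borel_measurable_continuous_on_indicator[OF bS contD])
  have FTC: "(E has_integral (f b - f a)) {a..b}"
    by (rule fundamental_theorem_of_calculus_interior_strong[OF S(1) \<open>a \<le> b\<close> _ contf])
      (auto simp: E_def D)
  have AES: "AE t in lborel. t \<notin> insert a (insert b S)"
    using S(1) by (intro AE_not_in countable_imp_null_set_lborel) (auto intro: countable_finite)
  have le: "(\<integral>\<^sup>+t. ennreal (c * norm (E t)) \<partial>lborel) \<le> (\<integral>\<^sup>+t\<in>{a..b}. h t \<partial>lborel)"
  proof (rule nn_integral_mono_AE, use AES in eventually_elim)
    fix t assume t: "t \<notin> insert a (insert b S)"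
    show "ennreal (c * norm (E t)) \<le> h t * indicator {a..b} t"
      using t h[of t "D t"] D[of t] by (cases "t \<in> {a..b}") (auto simp: E_def)
  qed
  \<comment> \<open>\<open>E\<close> is always gauge integrable, but the norm estimate needs absolute integrability.\<close>
  show ?thesis
  proof (cases "(\<integral>\<^sup>+t. ennreal (norm (E t)) \<partial>lborel) = \<infinity>")
    case True
    show ?thesis
    proof (cases "c = 0")
      case False
      have "(\<integral>\<^sup>+t. ennreal (c * norm (E t)) \<partial>lborel) = ennreal c * (\<integral>\<^sup>+t. ennreal (norm (E t)) \<partial>lborel)"
        using Em \<open>0 \<le> c\<close> by (subst nn_integral_cmult[symmetric]) (auto simp: ennreal_mult)
      also have "\<dots> = \<infinity>" using False \<open>0 \<le> c\<close> True by (simp add: ennreal_mult_eq_top_iff)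
      finally show ?thesis using le by (simp add: top.extremum_unique)
    qed simp
  next
    case False
    have int: "integrable lborel E"
      using Em False by (simp add: integrable_iff_bounded less_top)
    have "(E has_integral integral\<^sup>L lborel E) UNIV"
      by (rule has_integral_integral_lborel[OF int])
    moreover have "(E has_integral (f b - f a)) UNIV"
      by (rule has_integral_on_superset[OF FTC]) (auto simp: E_def)
    ultimately have "f b - f a = integral\<^sup>L lborel E"
      by (rule has_integral_unique[rotated])
    then have "norm (f b - f a) \<le> (\<integral>t. norm (E t) \<partial>lborel)"
      using integral_norm_bound by metis
    then have "ennreal (c * norm (f b - f a)) \<le> ennreal (\<integral>t. c * norm (E t) \<partial>lborel)"
      using \<open>0 \<le> c\<close> by (auto intro!: ennreal_leI mult_left_mono)
    also have "\<dots> = (\<integral>\<^sup>+t. ennreal (c * norm (E t)) \<partial>lborel)"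
      using int \<open>0 \<le> c\<close> by (intro nn_integral_eq_integral[symmetric]) auto
    finally show ?thesis using le by simp
  qed
qed

text \<open>
  The curve with straight coordinate image competes in the infimum that defines the distance, and its
  speed is at most \<open>C * norm (q - q0)\<close>. Membership in \<open>curves_between\<close> requires
  regularity in every chart, not only in the given one; this is where smoothness of the transition maps enters.
\<close>

lemma dist_le_coordinate_distance:
  fixes A :: "('a::{metric_space,second_countable_topology}, 'n::finite) chart set"
  assumes riem: "riemannian_manifold A g" and c: "(U, \<phi>) \<in> A"
    and seg: "closed_segment q0 q \<subseteq> \<phi> ` U" and "0 \<le> C"
    and bound: "\<And>p w. p \<in> closed_segment q0 q \<Longrightarrow>
      sqrt (w \<bullet> (g (U, \<phi>) (inv_into U \<phi> p) *v w)) \<le> C * norm w"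
  shows curves_between_segment: "curves_between A (inv_into U \<phi> q0) (inv_into U \<phi> q) \<noteq> {}"
    and dist_le_coordinates: "dist (inv_into U \<phi> q0) (inv_into U \<phi> q) \<le> C * norm (q - q0)"
proof -
  have A: "smooth_atlas A" and g: "riemannian_metric A g"
    using riem by (auto simp: riemannian_manifold_def)
  define l where "l t = q0 + t *\<^sub>R (q - q0)" for t :: real
  define \<gamma> where "\<gamma> = inv_into U \<phi> \<circ> l"
  have l: "l t \<in> closed_segment q0 q" if "t \<in> {0..1}" for t
    using that by (auto simp: l_def in_segment algebra_simps intro!: exI[of _ t])
  have l': "l t \<in> \<phi> ` U" if "t \<in> {0..1}" for t using l[OF that] seg by auto
  have contl: "continuous_on S l" for S unfolding l_def by (intro continuous_intros)
  have dl: "(l has_vector_derivative (q - q0)) (at t)" for t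
    unfolding l_def by (auto intro!: derivative_eq_intros)
  \<comment> \<open>The curve extends to an open parameter set, so two-sided derivatives exist at the end points.\<close>
  define W where "W = l -` (\<phi> ` U)"
  have W: "open W" "{0..1} \<subseteq> W"
    using chart_image_open[OF A c] contl[of UNIV] l' by (auto simp: W_def open_vimage)
  have cont\<gamma>: "continuous_on W \<gamma>" unfolding \<gamma>_def W_def
    by (intro continuous_on_compose contl continuous_on_subset[OF chart_inv_cont[OF A c]]) auto
  have isCont: "isCont \<gamma> t" if "t \<in> {0..1}" for t
    using cont\<gamma> W that continuous_on_eq_continuous_at by blast
  have \<gamma>U: "\<gamma> t \<in> U" if "t \<in> W" for t
    using that by (simp add: \<gamma>_def W_def inv_into_into)
  have \<phi>\<gamma>: "\<phi> (\<gamma> t) = l t" if "t \<in> W" for t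
    using that unfolding \<gamma>_def W_def by (simp add: f_inv_into_f)
  have pw: "piecewise_C1_curve A \<gamma>"
    unfolding piecewise_C1_curve_def
  proof safe
    show "path \<gamma>" unfolding path_def using continuous_on_subset[OF cont\<gamma> W(2)] .
    fix V \<psi> and a b :: real
    assume V: "(V, \<psi>) \<in> A" and ab: "{a..b} \<subseteq> {0..1}" and \<gamma>V: "\<gamma> ` {a..b} \<subseteq> V"
    define F where "F = \<psi> \<circ> inv_into U \<phi>"
    have F: "smooth_on (\<phi> ` (U \<inter> V)) F"
      using A c V unfolding smooth_atlas_def F_def by blast
    have mem: "l t \<in> \<phi> ` (U \<inter> V)" if "t \<in> {a..b}" for t
    proof -
      have "t \<in> W" using that ab W by auto
      then show ?thesis using \<phi>\<gamma>[of t] \<gamma>U[of t] \<gamma>V that by (metis IntI image_eqI image_subset_iff)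
    qed
    define D where "D t = frechet_derivative F (at (l t)) (q - q0)" for t
    have "(\<psi> \<circ> \<gamma> has_vector_derivative D t) (at t)" if t: "t \<in> {a..b}" for t
    proof -
      have "(F has_derivative frechet_derivative F (at (l t))) (at (l t))" (is "(F has_derivative ?J) _")
        using smooth_on_imp_differentiable[OF F mem[OF t]] frechet_derivative_works by blast
      moreover have "(l has_derivative (\<lambda>s. s *\<^sub>R (q - q0))) (at t)"
        using dl by (simp add: has_vector_derivative_def)
      ultimately have "(F \<circ> l has_derivative ?J \<circ> (\<lambda>s. s *\<^sub>R (q - q0))) (at t)"
        using diff_chain_at by blast
      moreover have "linear ?J" by (rule has_derivative_linear) fact
      ultimately show ?thesis
        by (simp add: has_vector_derivative_def o_def linear_scale D_def F_def \<gamma>_def)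
    qed
    moreover have "continuous_on {a..b} D" unfolding D_def
      by (rule continuous_on_compose2[OF smooth_on_imp_continuous_derivative[OF F] contl])
        (use mem in auto)
    ultimately show "\<psi> \<circ> \<gamma> piecewise_C1_differentiable_on {a..b}"
      by (intro C1_differentiable_imp_piecewise) (unfold C1_differentiable_on_def, blast)
  qed
  have ends: "pathstart \<gamma> = inv_into U \<phi> q0" "pathfinish \<gamma> = inv_into U \<phi> q"
    by (auto simp: pathstart_def pathfinish_def \<gamma>_def l_def)
  then have mem: "\<gamma> \<in> curves_between A (inv_into U \<phi> q0) (inv_into U \<phi> q)"
    using pw by (simp add: curves_between_def)
  then show ne: "curves_between A (inv_into U \<phi> q0) (inv_into U \<phi> q) \<noteq> {}" by blast
  have speed: "curve_speed A g \<gamma> t \<le> C * norm (q - q0)" if t: "t \<in> {0..1}" for t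
  proof -
    have "(\<phi> \<circ> \<gamma> has_vector_derivative (q - q0)) (at t)"
      by (rule has_vector_derivative_transform_within_open[OF dl W(1)]) (use t W \<phi>\<gamma> in auto)
    from curve_speed_in_chart[OF A g c isCont[OF t] _ this]
    have "curve_speed A g \<gamma> t = sqrt ((q - q0) \<bullet> (g (U, \<phi>) (inv_into U \<phi> (l t)) *v (q - q0)))"
      using \<gamma>U t W by (auto simp: \<gamma>_def)
    then show ?thesis using bound[OF l[OF t]] by simp
  qed
  have "ennreal (dist (inv_into U \<phi> q0) (inv_into U \<phi> q)) \<le> curve_length A g \<gamma>"
    using riem ne mem unfolding riemannian_manifold_def by (auto intro: INF_lower)
  also have "\<dots> \<le> (\<integral>\<^sup>+t. ennreal (C * norm (q - q0)) * indicator {0..1} (t::real) \<partial>lborel)"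
    unfolding curve_length_def
    by (intro nn_integral_mono) (auto simp: indicator_def intro!: ennreal_leI speed)
  also have "\<dots> = ennreal (C * norm (q - q0))"
    by (subst nn_integral_cmult_indicator) auto
  finally show "dist (inv_into U \<phi> q0) (inv_into U \<phi> q) \<le> C * norm (q - q0)"
    using \<open>0 \<le> C\<close> by (simp add: ennreal_le_iff)
qed

text \<open>
  Up to the first time at which the curve leaves the open coordinate ball of radius \<open>s\<close>, it stays in
  the compact coordinate ball, where its coordinate speed is controlled by its Riemannian speed. At
  that time the coordinate distance from the centre is \<open>s\<close>. This covers
  curves that leave the domain of the chart and come back.
\<close>

lemma curve_length_ge_coordinate_radius:
  fixes A :: "('a::metric_space, 'n::finite) chart set"
  assumes A: "smooth_atlas A" and g: "riemannian_metric A g" and c: "(U, \<phi>) \<in> A"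
    and "0 < s" and "0 \<le> k" and sub: "cball q0 s \<subseteq> \<phi> ` U"
    and bound: "\<And>p w. p \<in> cball q0 s \<Longrightarrow>
      k * norm w \<le> sqrt (w \<bullet> (g (U, \<phi>) (inv_into U \<phi> p) *v w))"
    and \<gamma>: "\<gamma> \<in> curves_between A (inv_into U \<phi> q0) x"
    and x: "x \<notin> inv_into U \<phi> ` ball q0 s"
  shows "ennreal (k * s) \<le> curve_length A g \<gamma>"
proof -
  have cont\<gamma>: "continuous_on {0..1} \<gamma>" and ends: "\<gamma> 0 = inv_into U \<phi> q0" "\<gamma> 1 = x"
    using \<gamma> unfolding curves_between_def piecewise_C1_curve_def path_def pathstart_def pathfinish_def
    by auto
  have pw: "(\<phi> \<circ> \<gamma>) piecewise_C1_differentiable_on {a..b}"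
    if "{a..b} \<subseteq> {0..1}" "\<gamma> ` {a..b} \<subseteq> U" for a b
    using \<gamma> c that unfolding curves_between_def piecewise_C1_curve_def by blast
  define W where "W = inv_into U \<phi> ` ball q0 s"
  define K where "K = inv_into U \<phi> ` cball q0 s"
  have WK: "W \<subseteq> K" unfolding W_def K_def by auto
  have KU: "K \<subseteq> U" using sub by (auto simp: K_def inv_into_into)
  have W_eq: "W = U \<inter> \<phi> -` ball q0 s"
  proof -
    have "ball q0 s \<subseteq> \<phi> ` U" using sub by auto
    then show ?thesis unfolding W_def
      by (auto simp: f_inv_into_f inv_into_into chart_inv[OF A c] subset_eq image_iff Bex_def
        intro!: exI[of _ "\<phi> _"]; metis chart_inv[OF A c])
  qed
  have "open W" unfolding W_eq
    by (intro continuous_open_preimage chart_cont[OF A c] chart_open[OF A c] open_ball)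
  have "compact K" unfolding K_def
    by (intro compact_continuous_image continuous_on_subset[OF chart_inv_cont[OF A c] sub]) auto
  then have "closed K" by (rule compact_imp_closed)
  have inv: "\<phi> (inv_into U \<phi> p) = p" if "p \<in> cball q0 s" for p
    using that sub by (intro f_inv_into_f) auto
  have \<phi>K: "\<phi> y \<in> cball q0 s \<and> inv_into U \<phi> (\<phi> y) = y" if "y \<in> K" for y
    using that KU by (auto simp: K_def inv chart_inv[OF A c])
  define E where "E = {0..1} \<inter> \<gamma> -` (- W)"
  have "closed E" unfolding E_def
    by (rule continuous_closed_preimage[OF cont\<gamma>]) (use \<open>open W\<close> in auto)
  moreover have "1 \<in> E" using x ends by (auto simp: E_def W_def)
  moreover have bdd: "bdd_below E" unfolding E_def by (auto intro!: bdd_belowI[of _ 0])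
  ultimately have t1E: "Inf E \<in> E" using closed_contains_Inf by blast
  define b where "b = Inf E"
  have b: "b \<in> {0..1}" "\<gamma> b \<notin> W" using t1E by (auto simp: E_def b_def)
  have "\<gamma> 0 \<in> W" using ends \<open>0 < s\<close> by (auto simp: W_def)
  then have "0 < b" using b by (cases "b = 0") auto
  have before: "\<gamma> t \<in> W" if "t \<in> {0..<b}" for t
  proof (rule ccontr)
    assume "\<gamma> t \<notin> W"
    then have "t \<in> E" using that b by (auto simp: E_def)
    then have "b \<le> t" unfolding b_def using bdd by (rule cInf_lower)
    then show False using that by simp
  qed
  \<comment> \<open>By compactness the exit point still lies in the domain of the chart.\<close>
  have cl: "closure {0..<b} = {0..b}" using \<open>0 < b\<close> by simp
  have "\<gamma> ` closure {0..<b} \<subseteq> K"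
    by (rule image_closure_subset[OF _ \<open>closed K\<close>])
      (use cl b before WK in \<open>auto intro: continuous_on_subset[OF cont\<gamma>]\<close>)
  then have inK: "\<gamma> t \<in> K" if "t \<in> {0..b}" for t using that cl by auto
  have "\<phi> (\<gamma> b) \<notin> ball q0 s" using b inK[of b] KU \<open>0 < b\<close> by (auto simp: W_eq)
  then have far: "s \<le> norm (\<phi> (\<gamma> b) - \<phi> (\<gamma> 0))"
    using inv[of q0] \<open>0 < s\<close> by (simp add: ends dist_norm norm_minus_commute)
  have "ennreal (k * s) \<le> ennreal (k * norm ((\<phi> \<circ> \<gamma>) b - (\<phi> \<circ> \<gamma>) 0))"
    using far \<open>0 \<le> k\<close> by (auto intro!: ennreal_leI mult_left_mono)
  also have "\<dots> \<le> (\<integral>\<^sup>+t\<in>{0..b}. ennreal (curve_speed A g \<gamma> t) \<partial>lborel)"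
  proof (rule norm_increment_le_nn_integral)
    show "(\<phi> \<circ> \<gamma>) piecewise_C1_differentiable_on {0..b}"
      by (rule pw) (use b inK KU in auto)
    fix t w assume t: "t \<in> {0<..<b}" and w: "(\<phi> \<circ> \<gamma> has_vector_derivative w) (at t)"
    have "isCont \<gamma> t"
      using cont\<gamma> t b by (intro continuous_on_interior[of "{0..1}"]) auto
    moreover have "\<gamma> t \<in> K" using t inK by auto
    ultimately have "curve_speed A g \<gamma> t = sqrt (w \<bullet> (g (U, \<phi>) (\<gamma> t) *v w))"
      using curve_speed_in_chart[OF A g c _ _ w] KU by auto
    then show "ennreal (k * norm w) \<le> ennreal (curve_speed A g \<gamma> t)"
      using bound[of "\<phi> (\<gamma> t)" w] \<phi>K[OF \<open>\<gamma> t \<in> K\<close>] by (auto intro: ennreal_leI)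
  qed (use \<open>0 < b\<close> \<open>0 \<le> k\<close> in auto)
  also have "\<dots> \<le> curve_length A g \<gamma>"
    unfolding curve_length_def using b
    by (intro nn_integral_mono) (auto simp: indicator_def)
  finally show ?thesis .
qed

section \<open>Measures of small balls\<close>

text \<open>
  The two comparisons of distance with coordinate distance put the coordinate image of the ball of
  radius \<open>r\<close> between coordinate balls of radii \<open>r / K\<close> and \<open>r / k\<close>; on these the volume density lies
  between \<open>k\<close> and \<open>K\<close>.
\<close>

lemma riemannian_volume_ball_bounds:
  fixes A :: "('a::{metric_space,second_countable_topology}, 'n::finite) chart set"
  assumes riem: "riemannian_manifold A g" and vol: "is_riemannian_volume A g vol"
  obtains c C R where "0 < c" "0 < C" "0 < R"
    "\<And>r. 0 < r \<Longrightarrow> r < R \<Longrightarrow> ennreal (c * r ^ CARD('n)) \<le> emeasure vol (ball x0 r)"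
    "\<And>r. 0 < r \<Longrightarrow> r < R \<Longrightarrow> emeasure vol (ball x0 r) \<le> ennreal (C * r ^ CARD('n))"
proof -
  have A: "smooth_atlas A" and g: "riemannian_metric A g"
    using riem by (auto simp: riemannian_manifold_def)
  have "(\<Union>(U, \<phi>)\<in>A. U) = UNIV" using A by (simp add: smooth_atlas_def)
  then obtain U \<phi> where c: "(U, \<phi>) \<in> A" and x0: "x0 \<in> U" by blast
  define \<iota> where "\<iota> = inv_into U \<phi>"
  define q0 where "q0 = \<phi> x0"
  have \<iota>: "\<iota> (\<phi> x) = x" if "x \<in> U" for x using chart_inv[OF A c that] by (simp add: \<iota>_def)
  have \<phi>\<iota>: "\<phi> (\<iota> q) = q" "\<iota> q \<in> U" if "q \<in> \<phi> ` U" for q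
    using that by (auto simp: \<iota>_def f_inv_into_f inv_into_into)
  obtain \<delta> where \<delta>: "0 < \<delta>" "cball q0 \<delta> \<subseteq> \<phi> ` U"
    using chart_image_open[OF A c] x0 open_contains_cball unfolding q0_def by blast
  define G where "G q = g (U, \<phi>) (\<iota> q)" for q
  have gU: "smooth_on (\<phi> ` U) G" "\<And>x v. x \<in> U \<Longrightarrow> v \<noteq> 0 \<Longrightarrow> 0 < v \<bullet> (g (U, \<phi>) x *v v)"
    using g c unfolding riemannian_metric_def G_def \<iota>_def by blast+
  obtain k K where k: "0 < k" "0 < K"
    and lo: "\<And>q v. q \<in> cball q0 \<delta> \<Longrightarrow> k * norm v \<le> sqrt (v \<bullet> (G q *v v))"
    and hi: "\<And>q v. q \<in> cball q0 \<delta> \<Longrightarrow> sqrt (v \<bullet> (G q *v v)) \<le> K * norm v"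
    and dlo: "\<And>q. q \<in> cball q0 \<delta> \<Longrightarrow> k \<le> sqrt (det (G q))"
    and dhi: "\<And>q. q \<in> cball q0 \<delta> \<Longrightarrow> sqrt (det (G q)) \<le> K"
  proof (rule positive_definite_family_bounds[of "cball q0 \<delta>" G])
    show "continuous_on (cball q0 \<delta>) G"
      using smooth_on_imp_continuous_on[OF gU(1)] \<delta>(2) by (rule continuous_on_subset)
    show "0 < v \<bullet> (G q *v v)" if "q \<in> cball q0 \<delta>" "v \<noteq> 0" for q v
      unfolding G_def using that \<delta> by (intro gU(2) \<phi>\<iota>) auto
  qed (auto intro: that)
  have seg: "closed_segment q0 q \<subseteq> cball q0 \<delta>" if "q \<in> cball q0 \<delta>" for q
    using that \<delta> by (intro closed_segment_subset) auto
  have \<iota>0: "\<iota> q0 = x0" using x0 \<iota> by (simp add: q0_def)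
  have curves: "curves_between A x0 (\<iota> q) \<noteq> {}" and dist_hi: "dist x0 (\<iota> q) \<le> K * norm (q - q0)"
    if "q \<in> cball q0 \<delta>" for q
    using curves_between_segment[OF riem c, of q0 q K, folded \<iota>_def]
      dist_le_coordinates[OF riem c, of q0 q K, folded \<iota>_def]
      seg[OF that] \<delta> hi k(2) by (force simp: \<iota>0 G_def)+
  have dist_lo: "k * norm (q - q0) \<le> dist x0 (\<iota> q)" if q: "q \<in> cball q0 \<delta>" for q
  proof (cases "q = q0")
    case False
    define s where "s = norm (q - q0)"
    have s: "0 < s" "s \<le> \<delta>" using False q by (auto simp: s_def dist_norm norm_minus_commute)
    have notin: "\<iota> q \<notin> \<iota> ` ball q0 s"
    proof
      assume "\<iota> q \<in> \<iota> ` ball q0 s"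
      then obtain q' where q': "q' \<in> ball q0 s" "\<iota> q = \<iota> q'" by blast
      then have "q' \<in> \<phi> ` U" "q \<in> \<phi> ` U" using s \<delta> q by auto
      then have "q = q'" using q' \<phi>\<iota>(1) by metis
      then show False using q' by (simp add: s_def dist_norm norm_minus_commute)
    qed
    have "ennreal (k * s) \<le> (INF \<gamma>\<in>curves_between A x0 (\<iota> q). curve_length A g \<gamma>)"
    proof (rule INF_greatest)
      fix \<gamma> assume "\<gamma> \<in> curves_between A x0 (\<iota> q)"
      then show "ennreal (k * s) \<le> curve_length A g \<gamma>"
        using s k notin lo \<delta>
        by (intro curve_length_ge_coordinate_radius[OF A g c, of s k q0 \<gamma> "\<iota> q"])
          (auto simp: \<iota>0 \<iota>_def[symmetric] G_def)
    qed
    also have "\<dots> = ennreal (dist x0 (\<iota> q))"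
      using riem curves[OF q] unfolding riemannian_manifold_def by metis
    finally show ?thesis by (simp add: s_def)
  qed simp
  have "open (U \<inter> \<phi> -` ball q0 \<delta>)"
    by (intro continuous_open_preimage chart_cont[OF A c] chart_open[OF A c] open_ball)
  moreover have "x0 \<in> U \<inter> \<phi> -` ball q0 \<delta>" using x0 \<delta> by (simp add: q0_def)
  ultimately obtain R0 where R0: "0 < R0" "ball x0 R0 \<subseteq> U \<inter> \<phi> -` ball q0 \<delta>"
    using open_contains_ball by blast
  \<comment> \<open>\<open>R \<le> R0\<close> keeps the ball inside the coordinate ball of radius \<open>\<delta>\<close>, and \<open>R \<le> K * \<delta>\<close> makes
     the inner coordinate ball of radius \<open>r / K\<close> fit into it.\<close>
  define R where "R = min R0 (K * \<delta>)"
  define u where "u = measure lborel (ball (0 :: real ^ 'n) 1)"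
  have u: "0 < u" unfolding u_def by (rule content_ball_pos) simp
  have ball: "emeasure lborel (ball q r) = ennreal (u * r ^ CARD('n))" if "0 < r" for q :: "real ^ 'n" and r
    using that content_ball_conv_unit_ball[of r q] emeasure_lborel_ball_finite[of q r]
    by (simp add: emeasure_eq_ennreal_measure u_def mult.commute)
  have sub: "ball x0 r \<subseteq> U" "\<phi> ` ball x0 r \<subseteq> ball q0 \<delta>" if "r < R" for r
  proof -
    have "ball x0 r \<subseteq> ball x0 R0" using that by (intro subset_ball) (simp add: R_def)
    then show "ball x0 r \<subseteq> U" "\<phi> ` ball x0 r \<subseteq> ball q0 \<delta>" using R0 by auto
  qed
  have volume: "emeasure vol (ball x0 r) = (\<integral>\<^sup>+q\<in>\<phi> ` ball x0 r. ennreal (sqrt (det (G q))) \<partial>lborel)"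
    if "r < R" for r
    using vol c sub(1)[OF that] unfolding is_riemannian_volume_def G_def \<iota>_def by fastforce
  show ?thesis
  proof (rule that[of "k * (u / K ^ CARD('n))" "K * (u / k ^ CARD('n))" R])
    show "0 < k * (u / K ^ CARD('n))" "0 < K * (u / k ^ CARD('n))" "0 < R"
      using k u R0 \<delta> by (auto simp: R_def)
    fix r :: real assume r: "0 < r" "r < R"
    have inner: "ball q0 (r / K) \<subseteq> \<phi> ` ball x0 r"
    proof
      fix q assume q: "q \<in> ball q0 (r / K)"
      have "r / K < \<delta>" using r k by (simp add: R_def field_simps)
      then have q': "q \<in> cball q0 \<delta>" using q by simp
      have "K * norm (q - q0) < r"
        using q k by (simp add: dist_norm norm_minus_commute field_simps)
      then have "\<iota> q \<in> ball x0 r" using dist_hi[OF q'] by simp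
      then show "q \<in> \<phi> ` ball x0 r" using \<phi>\<iota>(1)[of q] q' \<delta> by (metis image_eqI subsetD)
    qed
    have outer: "\<phi> ` ball x0 r \<subseteq> ball q0 (r / k)"
    proof
      fix q assume q: "q \<in> \<phi> ` ball x0 r"
      then obtain x where x: "q = \<phi> x" "x \<in> ball x0 r" by blast
      have "q \<in> cball q0 \<delta>" using q sub(2)[OF r(2)] by auto
      from dist_lo[OF this] have "k * norm (q - q0) < r"
        using x \<iota>[of x] sub(1)[OF r(2)] by auto
      then show "q \<in> ball q0 (r / k)"
        using k by (simp add: dist_norm norm_minus_commute field_simps)
    qed
    have "ennreal (k * (u / K ^ CARD('n)) * r ^ CARD('n)) = ennreal k * emeasure lborel (ball q0 (r / K))"
      using k u r by (simp add: ball ennreal_mult[symmetric] power_divide)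
    also have "\<dots> = (\<integral>\<^sup>+q\<in>ball q0 (r / K). ennreal k \<partial>lborel)"
      by (simp add: nn_integral_cmult_indicator)
    also have "\<dots> \<le> emeasure vol (ball x0 r)" unfolding volume[OF r(2)]
    proof (rule nn_integral_mono)
      fix q
      show "ennreal k * indicator (ball q0 (r / K)) q
          \<le> ennreal (sqrt (det (G q))) * indicator (\<phi> ` ball x0 r) q"
        using inner sub(2)[OF r(2)] dlo[of q] by (auto simp: indicator_def intro!: ennreal_leI)
    qed
    finally show "ennreal (k * (u / K ^ CARD('n)) * r ^ CARD('n)) \<le> emeasure vol (ball x0 r)" .
    have "emeasure vol (ball x0 r) \<le> (\<integral>\<^sup>+q\<in>ball q0 (r / k). ennreal K \<partial>lborel)"
      unfolding volume[OF r(2)]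
    proof (rule nn_integral_mono)
      fix q
      show "ennreal (sqrt (det (G q))) * indicator (\<phi> ` ball x0 r) q
          \<le> ennreal K * indicator (ball q0 (r / k)) q"
        using outer sub(2)[OF r(2)] dhi[of q] by (auto simp: indicator_def intro!: ennreal_leI)
    qed
    also have "\<dots> = ennreal K * emeasure lborel (ball q0 (r / k))"
      by (simp add: nn_integral_cmult_indicator)
    also have "\<dots> = ennreal (K * (u / k ^ CARD('n)) * r ^ CARD('n))"
      using k u r by (simp add: ball ennreal_mult[symmetric] power_divide)
    finally show "emeasure vol (ball x0 r) \<le> ennreal (K * (u / k ^ CARD('n)) * r ^ CARD('n))" .
  qed
qed

lemma density_ball_bounds:
  fixes x0 :: "'a::metric_space"
  assumes sets: "sets vol = sets borel" and M: "M = density vol (\<lambda>x. ennreal (\<rho> x))" "prob_space M"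
    and \<rho>: "continuous_on UNIV \<rho>" "\<And>x. 0 < \<rho> x"
    and vol: "0 < c" "0 < C" "0 < R"
    "\<And>r. 0 < r \<Longrightarrow> r < R \<Longrightarrow> ennreal (c * r ^ d) \<le> emeasure vol (ball x0 r)"
    "\<And>r. 0 < r \<Longrightarrow> r < R \<Longrightarrow> emeasure vol (ball x0 r) \<le> ennreal (C * r ^ d)"
  obtains c' C' R' where "0 < c'" "0 < C'" "0 < R'"
    "\<And>r. 0 < r \<Longrightarrow> r < R' \<Longrightarrow> c' * r ^ d \<le> measure M (ball x0 r)"
    "\<And>r. 0 < r \<Longrightarrow> r < R' \<Longrightarrow> measure M (ball x0 r) \<le> C' * r ^ d"
proof -
  interpret prob_space M by fact
  define a where "a = \<rho> x0 / 2"
  have a: "0 < a" using \<rho>(2)[of x0] by (simp add: a_def)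
  have "isCont \<rho> x0" using \<rho>(1) by (simp add: continuous_on_eq_continuous_at)
  then obtain R1 where R1: "0 < R1" "\<And>x. dist x x0 < R1 \<Longrightarrow> dist (\<rho> x) (\<rho> x0) < a"
    using a unfolding continuous_at_eps_delta by blast
  define R' where "R' = min R R1"
  have bnd: "a \<le> \<rho> x \<and> \<rho> x \<le> 3 * a" if "x \<in> ball x0 r" "r < R'" for x r
  proof -
    have "\<bar>\<rho> x - \<rho> x0\<bar> < a"
      using R1(2)[of x] that by (simp add: R'_def dist_real_def dist_commute)
    moreover have "\<rho> x0 = 2 * a" by (simp add: a_def)
    ultimately show ?thesis by linarith
  qed
  have meas: "\<rho> \<in> borel_measurable vol"
    using borel_measurable_continuous_onI[OF \<rho>(1)] measurable_cong_sets[OF sets refl] by blast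
  have em: "emeasure M (ball x0 r) = (\<integral>\<^sup>+x\<in>ball x0 r. ennreal (\<rho> x) \<partial>vol)" for r
    unfolding M(1) by (rule emeasure_density) (use meas sets in auto)
  show ?thesis
  proof (rule that[of "a * c" "3 * a * C" R'])
    show "0 < a * c" "0 < 3 * a * C" "0 < R'" using a vol R1 by (auto simp: R'_def)
    fix r assume r: "0 < r" "r < R'"
    then have r': "r < R" by (simp add: R'_def)
    have bs: "ball x0 r \<in> sets vol" using sets by simp
    have "ennreal (a * c * r ^ d) = ennreal a * ennreal (c * r ^ d)"
      using a vol r by (simp add: ennreal_mult[symmetric] mult.assoc)
    also have "\<dots> \<le> ennreal a * emeasure vol (ball x0 r)"
      by (intro mult_left_mono vol(4)) (use r r' in auto)
    also have "\<dots> = (\<integral>\<^sup>+x\<in>ball x0 r. ennreal a \<partial>vol)"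
      using bs by (simp add: nn_integral_cmult_indicator)
    also have "\<dots> \<le> emeasure M (ball x0 r)" unfolding em
      by (intro nn_integral_mono) (use bnd r in \<open>auto simp: indicator_def intro!: ennreal_leI\<close>)
    finally show "a * c * r ^ d \<le> measure M (ball x0 r)"
      by (simp add: emeasure_eq_measure)
    have "emeasure M (ball x0 r) \<le> (\<integral>\<^sup>+x\<in>ball x0 r. ennreal (3 * a) \<partial>vol)" unfolding em
      by (intro nn_integral_mono) (use bnd r in \<open>auto simp: indicator_def intro!: ennreal_leI\<close>)
    also have "\<dots> = ennreal (3 * a) * emeasure vol (ball x0 r)"
      using bs by (simp add: nn_integral_cmult_indicator)
    also have "\<dots> \<le> ennreal (3 * a) * ennreal (C * r ^ d)"
      by (intro mult_left_mono vol(5)) (use r r' in auto)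
    also have "\<dots> = ennreal (3 * a * C * r ^ d)"
      using a vol r by (simp add: ennreal_mult[symmetric] mult.assoc)
    finally show "measure M (ball x0 r) \<le> 3 * a * C * r ^ d"
      using a vol r by (simp add: emeasure_eq_measure)
  qed
qed

section \<open>Hitting exponents along dyadic radii\<close>

lemma half_power_tendsto: "filterlim (\<lambda>k. (1/2 :: real)^k) (at_right 0) sequentially"
  by (auto simp: filterlim_at intro!: LIMSEQ_power_zero)

lemma hitting_time_props:
  assumes "1 \<le> n" "(T ^^ n) x \<in> ball x0 r"
  shows hitting_time_ge_1: "1 \<le> hitting_time T r x x0"
    and hitting_time_hits: "(T ^^ hitting_time T r x x0) x \<in> ball x0 r"
    and hitting_time_le: "hitting_time T r x x0 \<le> n"
  using LeastI[of "\<lambda>n. 1 \<le> n \<and> (T ^^ n) x \<in> ball x0 r" n]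
    Least_le[of "\<lambda>n. 1 \<le> n \<and> (T ^^ n) x \<in> ball x0 r" n] assms
  unfolding hitting_time_def by auto

text \<open>
  A limit superior over all radii dominates the one along the radii \<open>(1/2)^k\<close>. If some ball is never
  hit, the exponent is infinite.
\<close>

lemma upper_hitting_exponent_ge:
  assumes late: "\<forall>\<^sub>F k in sequentially. \<forall>n\<ge>1. (T ^^ n) x \<in> ball x0 ((1/2)^k) \<longrightarrow>
    ((1/2)^k) powr - \<alpha> < real n"
  shows "ereal \<alpha> \<le> upper_hitting_exponent T x x0"
proof (cases "\<forall>r>0. \<exists>n\<ge>1. (T ^^ n) x \<in> ball x0 r")
  case True
  define F where "F r = ereal (ln (real (hitting_time T r x x0)) / - ln r)" for r
  have "ereal \<alpha> \<le> Limsup (at_right 0) F"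
  proof (rule ccontr)
    assume "\<not> ?thesis"
    then have "\<forall>\<^sub>F r in at_right 0. F r < ereal \<alpha>" by (intro Limsup_lessD) simp
    then have "\<forall>\<^sub>F k in sequentially. F ((1/2)^k) < ereal \<alpha>"
      using half_power_tendsto unfolding filterlim_iff by blast
    moreover have "\<forall>\<^sub>F k::nat in sequentially. 1 \<le> k" by (rule eventually_ge_at_top)
    ultimately have "\<forall>\<^sub>F k::nat in sequentially. False" using late
    proof eventually_elim
      fix k :: nat
      define r where "r = (1/2 :: real)^k"
      assume k: "1 \<le> k" "F ((1/2)^k) < ereal \<alpha>"
        and late: "\<forall>n\<ge>1. (T ^^ n) x \<in> ball x0 ((1/2)^k) \<longrightarrow> ((1/2)^k) powr - \<alpha> < real n"
      have r: "0 < r" "r < 1" using k by (auto simp: r_def power_less_one_iff)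
      obtain n where n: "1 \<le> n" "(T ^^ n) x \<in> ball x0 r" using True r by blast
      have "r powr - \<alpha> < real (hitting_time T r x x0)"
        using late hitting_time_ge_1[where T=T, OF n] hitting_time_hits[where T=T, OF n] by (simp add: r_def)
      then have "ln (r powr - \<alpha>) \<le> ln (real (hitting_time T r x x0))"
        using r by (intro ln_mono) auto
      then have "\<alpha> * - ln r \<le> ln (real (hitting_time T r x x0))" using r by (simp add: ln_powr)
      then have "\<alpha> \<le> ln (real (hitting_time T r x x0)) / - ln r"
        using r by (subst pos_le_divide_eq) auto
      then show False using k(2) by (simp add: F_def r_def)
    qed
    then show False by simp
  qed
  then show ?thesis using True unfolding upper_hitting_exponent_def F_def by simp
next
  case False
  then show ?thesis unfolding upper_hitting_exponent_def by (subst if_not_P) auto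
qed

text \<open>
  The ball of radius \<open>r\<close> contains the largest dyadic ball of radius at most \<open>r\<close>, whose radius exceeds
  \<open>r / 2\<close>. Passing to it changes the bound only by a constant factor, which disappears after division
  by \<open>- ln r\<close>.
\<close>

lemma upper_hitting_exponent_le:
  assumes soon: "\<forall>\<^sub>F k in sequentially. \<exists>n\<ge>1. (T ^^ n) x \<in> ball x0 ((1/2)^k) \<and>
    real n \<le> C * ((1/2)^k) powr - \<beta>"
    and "0 < C" "0 \<le> \<beta>"
  shows "upper_hitting_exponent T x x0 \<le> ereal \<beta>"
proof -
  obtain k0 where k0: "\<And>k. k0 \<le> k \<Longrightarrow> \<exists>n\<ge>1. (T ^^ n) x \<in> ball x0 ((1/2)^k) \<and>
    real n \<le> C * ((1/2)^k) powr - \<beta>"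
    using soon unfolding eventually_sequentially by blast
  define L where "L = ln (C * 2 powr \<beta>)"
  have key: "\<exists>n\<ge>1. (T ^^ n) x \<in> ball x0 r \<and> ln (real n) \<le> L + \<beta> * - ln r"
    if r: "0 < r" "r < (1/2)^k0" for r
  proof -
    define k where "k = (LEAST k. (1/2)^k \<le> r)"
    obtain k1 where "(1/2)^k1 < r" using real_arch_pow_inv[OF r(1), of "1/2"] by auto
    then have kr: "(1/2)^k \<le> r" unfolding k_def using LeastI[of "\<lambda>k. (1/2)^k \<le> r" k1] by simp
    then have "(1/2 :: real)^k < (1/2)^k0" using r(2) by (rule order_le_less_trans)
    then have k: "k0 < k" using power_decreasing[of k k0 "1/2 :: real"] by (cases "k \<le> k0") auto
    then have "\<not> (1/2)^(k - 1) \<le> r"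
      using not_less_Least[of "k - 1" "\<lambda>k. (1/2)^k \<le> r"] unfolding k_def by linarith
    then have rk: "r / 2 < (1/2)^k" using k by (cases k) auto
    obtain n where n: "1 \<le> n" "(T ^^ n) x \<in> ball x0 ((1/2)^k)" "real n \<le> C * ((1/2)^k) powr - \<beta>"
      using k0[of k] k by auto
    have "real n \<le> C * (r / 2) powr - \<beta>"
      using n(3) rk r \<open>0 < C\<close> \<open>0 \<le> \<beta>\<close>
      by (elim order_trans) (intro mult_left_mono powr_mono2', auto)
    also have "\<dots> = (C * 2 powr \<beta>) * r powr - \<beta>"
      using r by (simp add: powr_divide powr_minus field_simps)
    finally have "ln (real n) \<le> ln ((C * 2 powr \<beta>) * r powr - \<beta>)"
      using n(1) by (intro ln_mono) auto
    also have "\<dots> = L + \<beta> * - ln r"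
      using r \<open>0 < C\<close> by (simp add: L_def ln_mult ln_powr)
    finally show ?thesis using n kr by (auto intro!: exI[of _ n])
  qed
  have hit: "\<forall>r>0. \<exists>n\<ge>1. (T ^^ n) x \<in> ball x0 r"
  proof safe
    fix r :: real assume "0 < r"
    then obtain n where "n \<ge> 1" "(T ^^ n) x \<in> ball x0 (min r ((1/2)^k0 / 2))"
      using key[of "min r ((1/2)^k0 / 2)"] by (auto simp: min_less_iff_disj)
    then show "\<exists>n\<ge>1. (T ^^ n) x \<in> ball x0 r" by auto
  qed
  define F where "F r = ereal (ln (real (hitting_time T r x x0)) / - ln r)" for r
  have "\<forall>\<^sub>F r in at_right 0. r \<in> {0<..<(min ((1/2)^k0) 1 :: real)}"
    by (rule eventually_at_right_real) simp
  then have "\<forall>\<^sub>F r in at_right 0. F r \<le> ereal (L / - ln r + \<beta>)"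
  proof eventually_elim
    fix r :: real assume "r \<in> {0<..<min ((1/2)^k0) 1}"
    then have r: "0 < r" "r < (1/2)^k0" "r < 1" by auto
    obtain n where n: "1 \<le> n" "(T ^^ n) x \<in> ball x0 r" "ln (real n) \<le> L + \<beta> * - ln r"
      using key[OF r(1,2)] by blast
    have "ln (real (hitting_time T r x x0)) \<le> ln (real n)"
      using hitting_time_ge_1[where T=T, OF n(1,2)] hitting_time_le[where T=T, OF n(1,2)] by (intro ln_mono) auto
    then have "ln (real (hitting_time T r x x0)) \<le> L + \<beta> * - ln r" using n(3) by simp
    moreover have "0 < - ln r" using r by simp
    ultimately have "ln (real (hitting_time T r x x0)) / - ln r \<le> (L + \<beta> * - ln r) / - ln r"
      by (intro divide_right_mono) auto
    also have "\<dots> = L / - ln r + \<beta>" using r by (simp add: field_simps)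
    finally show "F r \<le> ereal (L / - ln r + \<beta>)" by (simp add: F_def)
  qed
  then have "Limsup (at_right 0) F \<le> Limsup (at_right 0) (\<lambda>r. ereal (L / - ln r + \<beta>))"
    by (rule Limsup_mono)
  also have "\<dots> = ereal \<beta>"
  proof (rule lim_imp_Limsup)
    have "filterlim (\<lambda>r::real. - ln r) at_top (at_right 0)"
      using ln_at_0 by (simp add: filterlim_uminus_at_bot)
    then have "((\<lambda>r. L / - ln r) \<longlongrightarrow> 0) (at_right 0)"
      by (intro tendsto_divide_0[OF tendsto_const] filterlim_at_top_imp_at_infinity)
    from tendsto_add[OF this tendsto_const[of \<beta>]]
    show "((\<lambda>r. ereal (L / - ln r + \<beta>)) \<longlongrightarrow> ereal \<beta>) (at_right 0)" by simp
  qed simp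
  finally show ?thesis using hit unfolding upper_hitting_exponent_def F_def by simp
qed

section \<open>Observables and decay of correlations\<close>

text \<open>
  The cut-off descends from \<open>1\<close> to \<open>0\<close> between the radii \<open>r / 2\<close> and \<open>r\<close>. Its slope \<open>2 / r\<close>, squared,
  is the source of the summand \<open>2\<close> in the numerator of \<open>(2 * d + 2) / p\<close>.
\<close>

lemma cutoff_function:
  fixes x0 :: "'a::metric_space"
  assumes r: "0 < r"
  obtains f :: "'a \<Rightarrow> real" where
    "lipschitz_observable f" "lipschitz_norm f \<le> 1 + 2 / r" "0 \<le> lipschitz_norm f"
    "\<And>x. 0 \<le> f x" "\<And>x. f x \<le> 1"
    "\<And>x. x \<in> ball x0 (r / 2) \<Longrightarrow> f x = 1" "\<And>x. f x \<noteq> 0 \<Longrightarrow> x \<in> ball x0 r"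
proof
  define f where "f x = max 0 (min 1 (2 - 2 / r * dist x x0))" for x :: 'a
  have clip: "\<bar>max 0 (min 1 a) - max 0 (min 1 b)\<bar> \<le> \<bar>a - b\<bar>" for a b :: real
    by (auto simp: max_def min_def)
  have lip: "(2 / r)-lipschitz_on UNIV f"
  proof (rule lipschitz_onI)
    fix x y :: 'a
    have "dist (f x) (f y) \<le> \<bar>2 / r * dist y x0 - 2 / r * dist x x0\<bar>"
      unfolding f_def dist_real_def by (rule order_trans[OF clip]) simp
    also have "\<dots> = 2 / r * \<bar>dist y x0 - dist x x0\<bar>"
      using r by (simp add: right_diff_distrib[symmetric] abs_mult del: times_divide_eq_left)
    also have "\<dots> \<le> 2 / r * dist x y"
      using abs_dist_diff_le[of y x0 x] r by (intro mult_left_mono) (auto simp: dist_commute)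
    finally show "dist (f x) (f y) \<le> 2 / r * dist x y" .
  qed (use r in auto)
  show f: "0 \<le> f x" "f x \<le> 1" for x by (auto simp: f_def)
  show "lipschitz_observable f"
    unfolding lipschitz_observable_def
  proof
    show "bounded (range f)" using f by (auto simp: bounded_iff intro!: exI[of _ "1::real"])
  qed (use lip in blast)
  have bdd: "bdd_below {L. L-lipschitz_on UNIV f}"
    by (auto intro!: bdd_belowI[of _ 0] simp: lipschitz_on_def)
  have sup: "(SUP x. \<bar>f x\<bar>) \<le> 1" by (rule cSUP_least) (use f in auto)
  have "bdd_above (range (\<lambda>x. \<bar>f x\<bar>))" using f by (auto intro!: bdd_aboveI[of _ 1])
  from cSUP_upper[OF _ this, of x0] have sup0: "0 \<le> (SUP x. \<bar>f x\<bar>)" by (auto intro: order_trans[rotated])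
  have inf: "Inf {L. L-lipschitz_on UNIV f} \<le> 2 / r" by (rule cInf_lower[OF _ bdd]) (use lip in auto)
  have inf0: "0 \<le> Inf {L. L-lipschitz_on UNIV f}"
    proof (rule cInf_greatest)
    show "{L. L-lipschitz_on UNIV f} \<noteq> {}" using lip by blast
  qed (auto simp: lipschitz_on_def)
  show "lipschitz_norm f \<le> 1 + 2 / r" "0 \<le> lipschitz_norm f"
    unfolding lipschitz_norm_def using sup sup0 inf inf0 by auto
  show "f x = 1" if "x \<in> ball x0 (r / 2)" for x
    using that r by (auto simp: f_def dist_commute min_def field_simps)
  show "x \<in> ball x0 r" if "f x \<noteq> 0" for x
    using that r by (auto simp: f_def dist_commute max_def min_def field_simps split: if_splits)
qed

text \<open>
  Any exponent below the limit \<open>p\<close> holds as a genuine power bound for large \<open>n\<close>.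
\<close>

lemma power_law_decay_rate:
  assumes "power_law_decay M T p" "q < p"
  obtains n0 where "\<And>f n. n0 \<le> n \<Longrightarrow> lipschitz_observable f \<Longrightarrow> 0 \<le> lipschitz_norm f \<Longrightarrow>
      \<bar>(\<integral>x. f ((T ^^ n) x) * f x \<partial>M) - (\<integral>x. f x \<partial>M)\<^sup>2\<bar> \<le> (lipschitz_norm f)\<^sup>2 * real n powr - q"
proof -
  obtain \<Phi> :: "nat \<Rightarrow> real" where \<Phi>: "\<And>f h n. lipschitz_observable f \<Longrightarrow> lipschitz_observable h \<Longrightarrow>
      \<bar>(\<integral>x. f ((T ^^ n) x) * h x \<partial>M) - (\<integral>x. f x \<partial>M) * (\<integral>x. h x \<partial>M)\<bar>
        \<le> lipschitz_norm f * lipschitz_norm h * \<Phi> n"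
    and lim: "(\<lambda>n. - ln (\<Phi> n) / ln (real n)) \<longlonglongrightarrow> p"
    using assms(1) unfolding power_law_decay_def by blast
  obtain n1 where n1: "\<And>n. n1 \<le> n \<Longrightarrow> q < - ln (\<Phi> n) / ln (real n)"
    using order_tendstoD(1)[OF lim assms(2)] unfolding eventually_sequentially by blast
  show ?thesis
  proof (rule that[of "max 2 n1"])
    fix f :: "'a \<Rightarrow> real" and n
    assume n: "max 2 n1 \<le> n" and f: "lipschitz_observable f" "0 \<le> lipschitz_norm f"
    \<comment> \<open>The limit of the logarithms says nothing about nonpositive values, for which the bound is trivial.\<close>
    have "\<Phi> n \<le> real n powr - q"
    proof (cases "0 < \<Phi> n")
      case True
      have "0 < ln (real n)" using n by simp
      then have "q * ln (real n) < - ln (\<Phi> n)" using n1[of n] n by (simp add: field_simps)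
      then have "exp (ln (\<Phi> n)) \<le> exp (- q * ln (real n))" by (subst exp_le_cancel_iff) simp
      then show ?thesis using True n by (simp add: powr_def)
    next
      case False
      then show ?thesis by (meson linorder_not_le order_trans powr_ge_zero less_imp_le)
    qed
    then have "lipschitz_norm f * lipschitz_norm f * \<Phi> n \<le> (lipschitz_norm f)\<^sup>2 * real n powr - q"
      using f by (simp add: power2_eq_square mult_left_mono)
    then show "\<bar>(\<integral>x. f ((T ^^ n) x) * f x \<partial>M) - (\<integral>x. f x \<partial>M)\<^sup>2\<bar> \<le> (lipschitz_norm f)\<^sup>2 * real n powr - q"
      using \<Phi>[OF f(1) f(1), of n] by (simp add: power2_eq_square)
  qed
qed

lemma powr_half_power: "((1/2)^k) powr e = ((1/2) powr e)^k" for e :: real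
proof -
  have "((1/2)^k) powr e = ((1/2) powr real k) powr e" by (subst powr_realpow) auto
  also have "\<dots> = (1/2) powr (real k * e)" by (rule powr_powr)
  also have "\<dots> = ((1/2) powr e)^k" by (subst powr_power) auto
  finally show ?thesis .
qed

section \<open>Hitting probabilities in a measure-preserving system\<close>

locale invariant_borel_system = prob_space M
  for M :: "'a::{metric_space, second_countable_topology} measure" +
  fixes T :: "'a \<Rightarrow> 'a"
  assumes sets_M: "sets M = sets borel"
    and T_measurable: "T \<in> borel \<rightarrow>\<^sub>M borel"
    and T_invariant: "distr M M T = M"
begin

lemma iterate_measurable [measurable]: "T ^^ n \<in> M \<rightarrow>\<^sub>M M"
proof -
  have T: "T \<in> M \<rightarrow>\<^sub>M M"
    using T_measurable measurable_cong_sets[OF sets_M sets_M] by blast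
  show ?thesis
    by (induction n) (auto simp: o_def intro!: measurable_compose[OF _ T])
qed

lemma iterate_invariant: "distr M M (T ^^ n) = M"
proof (induction n)
  case (Suc n)
  have T: "T \<in> M \<rightarrow>\<^sub>M M" using iterate_measurable[of 1] by simp
  have "distr M M (T ^^ Suc n) = distr (distr M M (T ^^ n)) M T"
    unfolding distr_distr[OF T iterate_measurable] by (simp add: o_def)
  then show ?case using Suc T_invariant by metis
qed (simp add: id_def distr_id)

lemma integral_iterate:
  fixes f :: "'a \<Rightarrow> real"
  assumes "f \<in> borel_measurable M"
  shows "(\<integral>x. f ((T ^^ n) x) \<partial>M) = (\<integral>x. f x \<partial>M)"
  using integral_distr[OF iterate_measurable[of n] assms] by (simp add: iterate_invariant)

lemma prob_hit_by_time_le: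
  assumes B: "B \<in> sets M"
  shows "prob {x \<in> space M. \<exists>n\<in>{1..N}. (T ^^ n) x \<in> B} \<le> real N * prob B"
proof -
  have eq: "{x \<in> space M. \<exists>n\<in>{1..N}. (T ^^ n) x \<in> B} = (\<Union>n\<in>{1..N}. (T ^^ n) -` B \<inter> space M)"
    by auto
  have "prob (\<Union>n\<in>{1..N}. (T ^^ n) -` B \<inter> space M) \<le> (\<Sum>n\<in>{1..N}. prob ((T ^^ n) -` B \<inter> space M))"
    by (rule finite_measure_subadditive_finite) (auto intro: measurable_sets[OF iterate_measurable B])
  also have "\<dots> = (\<Sum>n\<in>{1..N}. prob B)"
    using measure_distr[OF iterate_measurable B] by (simp add: iterate_invariant)
  finally show ?thesis unfolding eq by simp
qed

text \<open>
  If all observations vanish, their sum deviates from its mean \<open>K * m\<close> by \<open>K * m\<close>, so Chebyshev's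
  inequality applies. By invariance, the covariance of the observations number \<open>i < j\<close> is the
  correlation at time \<open>g * (j - i) \<ge> g\<close>, hence at most \<open>\<eta>\<close>. The variance of one observation is at most \<open>m\<close>,
  because \<open>f\<^sup>2 \<le> f\<close>; this is much smaller than what the Lipschitz norm would give.
\<close>

lemma prob_miss_sparse_times_le:
  fixes f :: "'a \<Rightarrow> real"
  assumes meas [measurable]: "f \<in> borel_measurable M" and f: "\<And>x. 0 \<le> f x" "\<And>x. f x \<le> 1"
    and m: "m = (\<integral>x. f x \<partial>M)" "0 < m" and "1 \<le> K" and "0 \<le> \<eta>"
    and decay: "\<And>n. g \<le> n \<Longrightarrow> \<bar>(\<integral>x. f ((T ^^ n) x) * f x \<partial>M) - m\<^sup>2\<bar> \<le> \<eta>"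
  shows "prob {x \<in> space M. \<forall>i\<in>{1..K}. f ((T ^^ (g * i)) x) = 0} \<le> 1 / (real K * m) + \<eta> / m\<^sup>2"
proof -
  define Y where "Y i x = f ((T ^^ (g * i)) x)" for i :: nat and x
  have Ym [measurable]: "Y i \<in> borel_measurable M" for i unfolding Y_def by measurable
  have Yb: "0 \<le> Y i x" "Y i x \<le> 1" for i x using f by (auto simp: Y_def)
  have int: "integrable M (Y i)" "integrable M (\<lambda>x. Y i x * Y j x)" for i j
    using Yb by (auto intro!: integrable_const_bound[where B=1] simp: abs_mult mult_le_one)
  have EY: "expectation (Y i) = m" for i
    unfolding Y_def m(1) by (rule integral_iterate[OF meas])
  have pair: "expectation (\<lambda>x. Y i x * Y j x) = (\<integral>x. f ((T ^^ (g * (j - i))) x) * f x \<partial>M)" if "i \<le> j" for i j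
  proof -
    have "(T ^^ (g * (j - i))) ((T ^^ (g * i)) x) = (T ^^ (g * j)) x" for x
      using that by (simp add: funpow_add[symmetric, THEN fun_cong, unfolded o_def] diff_mult_distrib2)
    then have "(\<lambda>x. Y i x * Y j x) = (\<lambda>x. (\<lambda>y. f ((T ^^ (g * (j - i))) y) * f y) ((T ^^ (g * i)) x))"
      by (auto simp: Y_def mult.commute)
    then show ?thesis using integral_iterate[of "\<lambda>y. f ((T ^^ (g * (j - i))) y) * f y" "g * i"] by simp
  qed
  have cov_less: "expectation (\<lambda>x. Y i x * Y j x) - m\<^sup>2 \<le> \<eta>" if "i < j" for i j
  proof -
    have "g * 1 \<le> g * (j - i)" using that by (intro mult_le_mono2) simp
    then have "g \<le> g * (j - i)" by simp
    from decay[OF this] pair[of i j] that show ?thesis by auto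
  qed
  have cov: "expectation (\<lambda>x. Y i x * Y j x) - m\<^sup>2 \<le> (if i = j then m else 0) + \<eta>" for i j
  proof (cases i j rule: linorder_cases)
    case equal
    have "expectation (\<lambda>x. Y i x * Y i x) \<le> expectation (Y i)"
      by (rule integral_mono[OF int(2) int(1)]) (use Yb in \<open>auto intro: mult_left_le_one_le\<close>)
    moreover have "0 \<le> m\<^sup>2" by simp
    ultimately have "expectation (\<lambda>x. Y i x * Y i x) - m\<^sup>2 \<le> m + \<eta>"
      using EY[of i] \<open>0 \<le> \<eta>\<close> by linarith
    then show ?thesis using equal by simp
  next
    case greater
    then show ?thesis using cov_less[of j i] by (simp add: mult.commute)
  qed (use cov_less in auto)
  define S where "S x = (\<Sum>i=1..K. Y i x)" for x
  have Sm [measurable]: "S \<in> borel_measurable M" unfolding S_def by measurable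
  have ES: "expectation S = real K * m"
    unfolding S_def using int(1) by (simp add: EY)
  have S2: "(S x)\<^sup>2 = (\<Sum>i=1..K. \<Sum>j=1..K. Y i x * Y j x)" for x
    unfolding S_def power2_eq_square by (rule sum_product)
  have intS: "integrable M (\<lambda>x. (S x)\<^sup>2)" "integrable M S"
    unfolding S2 unfolding S_def using int by (auto intro!: Bochner_Integration.integrable_sum)
  have "variance S = expectation (\<lambda>x. (S x)\<^sup>2) - (real K * m)\<^sup>2"
    using variance_eq[OF intS(2,1)] ES by simp
  also have "\<dots> = (\<Sum>i=1..K. \<Sum>j=1..K. expectation (\<lambda>x. Y i x * Y j x) - m\<^sup>2)"
    unfolding S2 using int
    by (simp add: Bochner_Integration.integral_sum sum_subtractf power_mult_distrib power2_eq_square)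
  also have "\<dots> \<le> (\<Sum>i=1..K. \<Sum>j=1..K. (if i = j then m else 0) + \<eta>)"
    by (intro sum_mono cov)
  also have "\<dots> = real K * m + (real K)\<^sup>2 * \<eta>"
    by (simp add: sum.distrib power2_eq_square sum.delta distrib_left)
  finally have var: "variance S \<le> real K * m + (real K)\<^sup>2 * \<eta>" .
  have Km: "0 < real K * m" using \<open>1 \<le> K\<close> m by simp
  have "prob {x \<in> space M. \<forall>i\<in>{1..K}. f ((T ^^ (g * i)) x) = 0}
      \<le> prob {x \<in> space M. real K * m \<le> \<bar>S x - expectation S\<bar>}"
    using Km unfolding ES by (intro finite_measure_mono) (auto simp: S_def Y_def)
  also have "\<dots> \<le> variance S / (real K * m)\<^sup>2"
    by (rule Chebyshev_inequality[OF Sm intS(1) Km])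
  also have "\<dots> \<le> (real K * m + (real K)\<^sup>2 * \<eta>) / (real K * m)\<^sup>2"
    using var by (rule divide_right_mono) simp
  also have "\<dots> = 1 / (real K * m) + \<eta> / m\<^sup>2"
    using \<open>1 \<le> K\<close> \<open>0 < m\<close>
    by (simp add: add_divide_distrib power_mult_distrib) (simp add: power2_eq_square)
  finally show ?thesis .
qed

text \<open>
  The first \<open>r powr - (d - \<epsilon>)\<close> iterates hit the ball of radius \<open>r\<close> with probability at most
  \<open>C * r powr \<epsilon>\<close>, which is summable along the dyadic radii.
\<close>

lemma AE_eventually_not_hit_early:
  assumes R: "0 < R" and C: "0 \<le> C"
    and ball: "\<And>r. 0 < r \<Longrightarrow> r < R \<Longrightarrow> prob (ball x0 r) \<le> C * r ^ d"
    and "0 < \<epsilon>"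
  shows "AE x in M. \<forall>\<^sub>F k in sequentially. \<forall>n\<ge>1. (T ^^ n) x \<in> ball x0 ((1/2)^k) \<longrightarrow>
    ((1/2)^k) powr - (real d - \<epsilon>) < real n"
proof -
  define N where "N k = nat \<lfloor>((1/2)^k) powr - (real d - \<epsilon>)\<rfloor>" for k :: nat
  define bad where "bad k = {x \<in> space M. \<exists>n\<in>{1..N k}. (T ^^ n) x \<in> ball x0 ((1/2)^k)}" for k :: nat
  have b [measurable]: "ball x0 r \<in> sets M" for r by (simp add: sets_M)
  have bad: "bad k \<in> sets M" for k unfolding bad_def by measurable
  have small: "\<forall>\<^sub>F k in sequentially. (1/2 :: real)^k < R"
    by (rule order_tendstoD(2)[OF LIMSEQ_power_zero R]) simp
  have "\<forall>\<^sub>F k in sequentially. norm (prob (bad k)) \<le> C * ((1/2) powr \<epsilon>)^k"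
    using small
  proof eventually_elim
    fix k assume k: "(1/2 :: real)^k < R"
    define r where "r = (1/2 :: real)^k"
    have r: "0 < r" by (simp add: r_def)
    have N: "real (N k) \<le> r powr - (real d - \<epsilon>)"
      by (simp add: N_def r_def)
    have "prob (bad k) \<le> real (N k) * prob (ball x0 r)"
      unfolding bad_def r_def by (rule prob_hit_by_time_le[OF b])
    also have "\<dots> \<le> r powr - (real d - \<epsilon>) * (C * r ^ d)"
      using N ball[of r] k r by (intro mult_mono) (auto simp: r_def)
    also have "\<dots> = C * (r powr - (real d - \<epsilon>) * r powr real d)"
      using r by (simp add: powr_realpow)
    also have "\<dots> = C * r powr \<epsilon>" by (simp add: powr_add[symmetric])
    finally show "norm (prob (bad k)) \<le> C * ((1/2) powr \<epsilon>)^k"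
      by (simp add: r_def powr_half_power)
  qed
  moreover have "summable (\<lambda>k. C * ((1/2 :: real) powr \<epsilon>)^k)"
    using \<open>0 < \<epsilon>\<close> powr_less_mono2[of \<epsilon> "1/2" 1] by (intro summable_mult summable_geometric) simp
  ultimately have "summable (\<lambda>k. prob (bad k))"
    by (rule summable_comparison_test_ev)
  then have "AE x in M. \<forall>\<^sub>F k in sequentially. x \<in> space M - bad k"
    by (intro borel_cantelli_AE1 bad) (auto simp: emeasure_eq_measure)
  then show ?thesis
  proof eventually_elim
    fix x assume "\<forall>\<^sub>F k in sequentially. x \<in> space M - bad k"
    then show "\<forall>\<^sub>F k in sequentially. \<forall>n\<ge>1. (T ^^ n) x \<in> ball x0 ((1/2)^k) \<longrightarrow>
      ((1/2)^k) powr - (real d - \<epsilon>) < real n"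
    proof eventually_elim
      fix k assume k: "x \<in> space M - bad k"
      show "\<forall>n\<ge>1. (T ^^ n) x \<in> ball x0 ((1/2)^k) \<longrightarrow> ((1/2)^k) powr - (real d - \<epsilon>) < real n"
      proof safe
        fix n assume n: "1 \<le> n" "(T ^^ n) x \<in> ball x0 ((1/2)^k)"
        then have "N k < n" using k unfolding bad_def by force
        then show "((1/2)^k) powr - (real d - \<epsilon>) < real n" unfolding N_def by linarith
      qed
    qed
  qed
qed

text \<open>
  The gap is \<open>g = r powr - a\<close> and the number of observations is \<open>K = r powr - (d + \<epsilon>)\<close>, both rounded
  up, with \<open>a = (2 * d + 2) / p + \<epsilon>\<close>. As \<open>p * a > 2 * d + 2\<close>, there is still a \<open>q < p\<close> with
  \<open>q * a > 2 * d + 2\<close>, and then the correlation term \<open>r powr (q * a - 2 - 2 * d)\<close> is summable as well. The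
  factor \<open>4\<close> in the conclusion comes from rounding up twice.
\<close>

lemma AE_eventually_hit_soon:
  assumes decay: "power_law_decay M T p" and "0 < p"
    and R: "0 < R" and c: "0 < c"
    and ball: "\<And>r. 0 < r \<Longrightarrow> r < R \<Longrightarrow> c * r ^ d \<le> prob (ball x0 r)"
    and \<epsilon>: "0 < \<epsilon>"
  shows "AE x in M. \<forall>\<^sub>F k in sequentially. \<exists>n\<ge>1. (T ^^ n) x \<in> ball x0 ((1/2)^k) \<and>
    real n \<le> 4 * ((1/2)^k) powr - (real d + (2 * real d + 2) / p + 2 * \<epsilon>)"
proof -
  define a where "a = (2 * real d + 2) / p + \<epsilon>"
  have a: "0 < a" using \<open>0 < p\<close> \<epsilon> by (simp add: a_def add_nonneg_pos)
  have pa: "2 * real d + 2 < p * a" using \<open>0 < p\<close> \<epsilon> by (simp add: a_def field_simps)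
  then have "(2 * real d + 2) / a < p" using a by (simp add: field_simps)
  then obtain q where q': "(2 * real d + 2) / a < q" "q < p" using dense by blast
  have "0 \<le> (2 * real d + 2) / a" using a by simp
  then have q: "0 < q" "q < p" "(2 * real d + 2) / a < q" using q' by linarith+
  define e where "e = q * a - 2 - 2 * real d"
  have e: "0 < e" using q(3) a by (simp add: e_def field_simps)
  obtain n0 where n0: "\<And>f n. n0 \<le> n \<Longrightarrow> lipschitz_observable f \<Longrightarrow> 0 \<le> lipschitz_norm f \<Longrightarrow>
      \<bar>(\<integral>x. f ((T ^^ n) x) * f x \<partial>M) - (\<integral>x. f x \<partial>M)\<^sup>2\<bar> \<le> (lipschitz_norm f)\<^sup>2 * real n powr - q"
    using power_law_decay_rate[OF decay q(2)] by blast
  \<comment> \<open>The cut-off equals \<open>1\<close> only on the ball of half the radius.\<close>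
  define c' where "c' = c / 2 ^ d"
  have c': "0 < c'" using c by (simp add: c'_def)
  define g where "g k = nat \<lceil>((1/2)^k) powr - a\<rceil>" for k :: nat
  define K where "K k = nat \<lceil>((1/2)^k) powr - (real d + \<epsilon>)\<rceil>" for k :: nat
  have b [measurable]: "ball x0 r \<in> sets M" for r by (simp add: sets_M)
  define bad where "bad k = {x \<in> space M. \<forall>i\<in>{1..K k}. (T ^^ (g k * i)) x \<notin> ball x0 ((1/2)^k)}" for k :: nat
  have bad: "bad k \<in> sets M" for k unfolding bad_def by measurable
  have small: "\<forall>\<^sub>F k in sequentially. (1/2 :: real)^k < R"
    by (rule order_tendstoD(2)[OF LIMSEQ_power_zero R]) simp
  have "(1/2 :: real) powr a < 1" using powr_less_mono2[of a "1/2" 1] a by simp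
  then have "(\<lambda>k. ((1/2 :: real) powr a)^k) \<longlonglongrightarrow> 0" by (intro LIMSEQ_power_zero) simp
  moreover have "0 < 1 / (real n0 + 1)" by simp
  ultimately have large: "\<forall>\<^sub>F k in sequentially. ((1/2 :: real) powr a)^k < 1 / (real n0 + 1)"
    by (rule order_tendstoD(2))
  have "\<forall>\<^sub>F k in sequentially. norm (prob (bad k)) \<le>
      1 / c' * ((1/2) powr \<epsilon>)^k + 9 / c'\<^sup>2 * ((1/2) powr e)^k"
    using small large
  proof eventually_elim
    fix k assume k: "(1/2 :: real)^k < R" and k': "((1/2 :: real) powr a)^k < 1 / (real n0 + 1)"
    define r where "r = (1/2 :: real)^k"
    have r: "0 < r" "r \<le> 1" "r < R" using k by (auto simp: r_def power_le_one)
    have rd: "r ^ d = r powr real d" using r by (simp add: powr_realpow)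
    obtain f :: "'a \<Rightarrow> real" where f: "lipschitz_observable f" "lipschitz_norm f \<le> 1 + 2 / r" "0 \<le> lipschitz_norm f"
      "\<And>x. 0 \<le> f x" "\<And>x. f x \<le> 1"
      "\<And>x. x \<in> ball x0 (r / 2) \<Longrightarrow> f x = 1" "\<And>x. f x \<noteq> 0 \<Longrightarrow> x \<in> ball x0 r"
      using cutoff_function[OF r(1), of x0] by blast
    have "continuous_on UNIV f"
      using f(1) unfolding lipschitz_observable_def by (blast intro: lipschitz_on_continuous_on)
    then have meas [measurable]: "f \<in> borel_measurable M"
      using borel_measurable_continuous_onI measurable_cong_sets[OF sets_M refl] by blast
    define m where "m = (\<integral>x. f x \<partial>M)"
    have "c' * r ^ d \<le> prob (ball x0 (r / 2))"
      using ball[of "r / 2"] r by (simp add: c'_def power_divide)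
    also have "\<dots> = (\<integral>x. indicator (ball x0 (r / 2)) x \<partial>M)" by simp
    also have "\<dots> \<le> m" unfolding m_def
    proof (rule integral_mono)
      show "integrable M (indicator (ball x0 (r / 2)) :: 'a \<Rightarrow> real)"
        by (rule integrable_real_indicator) (auto simp: emeasure_eq_measure)
      show "integrable M f" by (rule integrable_const_bound[where B=1]) (use f(4,5) in auto)
      show "indicator (ball x0 (r / 2)) x \<le> f x" for x
        using f(4,6)[of x] by (auto simp: indicator_def)
    qed
    finally have m: "c' * r powr real d \<le> m" by (simp add: rd)
    then have mpos: "0 < m" using c' r by (intro less_le_trans[OF _ m]) simp
    have ra: "r powr - a \<le> real (g k)" unfolding g_def r_def by linarith
    have rK: "r powr - (real d + \<epsilon>) \<le> real (K k)" unfolding K_def r_def by linarith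
    have "r powr a < 1 / (real n0 + 1)" using k' by (simp add: r_def powr_half_power)
    then have "real n0 + 1 < r powr - a" using r by (simp add: powr_minus field_simps)
    then have gn0: "n0 \<le> g k" using ra by linarith
    have gpos: "0 < r powr - a" using r by simp
    have K1: "1 \<le> K k" using rK r by (cases "K k") (auto simp: not_le)
    define \<eta> where "\<eta> = 9 * r powr (q * a - 2)"
    have "prob (bad k) \<le> prob {x \<in> space M. \<forall>i\<in>{1..K k}. f ((T ^^ (g k * i)) x) = 0}"
      unfolding bad_def r_def[symmetric] using f(7) by (intro finite_measure_mono) auto
    also have "\<dots> \<le> 1 / (real (K k) * m) + \<eta> / m\<^sup>2"
    proof (rule prob_miss_sparse_times_le[OF meas f(4,5) m_def])
      show "0 < m" by (rule mpos)
      show "0 \<le> \<eta>" by (simp add: \<eta>_def)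
      fix n assume n: "g k \<le> n"
      have "\<bar>(\<integral>x. f ((T ^^ n) x) * f x \<partial>M) - m\<^sup>2\<bar> \<le> (lipschitz_norm f)\<^sup>2 * real n powr - q"
        unfolding m_def using n gn0 f by (intro n0) auto
      also have "\<dots> \<le> (3 / r)\<^sup>2 * (r powr - a) powr - q"
      proof (intro mult_mono power_mono)
        have "1 \<le> 1 / r" using r by simp
        then show "lipschitz_norm f \<le> 3 / r" using f(2) by simp
        show "real n powr - q \<le> (r powr - a) powr - q"
          using q n ra gpos by (intro powr_mono2') auto
      qed (use f in auto)
      also have "(r powr - a) powr - q = r powr (q * a)"
        unfolding powr_powr by (simp add: mult.commute)
      also have "(3 / r)\<^sup>2 = 9 * r powr - 2"
        using r by (simp add: power_divide powr_minus_divide powr_realpow[of r 2, simplified])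
      also have "9 * r powr - 2 * r powr (q * a) = 9 * (r powr - 2 * r powr (q * a))" by simp
      also have "\<dots> = \<eta>" by (simp add: \<eta>_def powr_add[symmetric] add.commute)
      finally show "\<bar>(\<integral>x. f ((T ^^ n) x) * f x \<partial>M) - m\<^sup>2\<bar> \<le> \<eta>" .
    qed (rule K1)
    also have "\<dots> \<le> 1 / (r powr - (real d + \<epsilon>) * (c' * r powr real d)) + \<eta> / (c' * r powr real d)\<^sup>2"
      using m mpos rK r K1 c'
      by (intro add_mono divide_left_mono mult_mono power_mono mult_pos_pos zero_less_power)
        (auto simp: \<eta>_def intro: less_le_trans)
    also have "r powr - (real d + \<epsilon>) * (c' * r powr real d) = c' * r powr - \<epsilon>"
      by (simp add: mult.left_commute powr_add[symmetric])
    also have "(c' * r powr real d)\<^sup>2 = c'\<^sup>2 * r powr (2 * real d)"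
      using r by (simp add: power_mult_distrib powr_power)
    also have "1 / (c' * r powr - \<epsilon>) + \<eta> / (c'\<^sup>2 * r powr (2 * real d))
        = 1 / c' * r powr \<epsilon> + 9 / c'\<^sup>2 * (r powr (q * a - 2) / r powr (2 * real d))"
      by (simp add: \<eta>_def powr_minus field_simps)
    also have "r powr (q * a - 2) / r powr (2 * real d) = r powr e"
      by (simp add: e_def powr_diff[symmetric])
    finally show "norm (prob (bad k)) \<le> 1 / c' * ((1/2) powr \<epsilon>)^k + 9 / c'\<^sup>2 * ((1/2) powr e)^k"
      by (simp add: r_def powr_half_power)
  qed
  moreover have geo: "summable (\<lambda>k. ((1/2 :: real) powr t)^k)" if "0 < t" for t
    using that powr_less_mono2[of t "1/2" 1] by (intro summable_geometric) simp
  then have "summable (\<lambda>k. 1 / c' * ((1/2 :: real) powr \<epsilon>)^k + 9 / c'\<^sup>2 * ((1/2) powr e)^k)"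
    using \<epsilon> e by (intro summable_add summable_mult) auto
  ultimately have "summable (\<lambda>k. prob (bad k))"
    by (rule summable_comparison_test_ev)
  then have "AE x in M. \<forall>\<^sub>F k in sequentially. x \<in> space M - bad k"
    by (intro borel_cantelli_AE1 bad) (auto simp: emeasure_eq_measure)
  then show ?thesis
  proof eventually_elim
    fix x assume "\<forall>\<^sub>F k in sequentially. x \<in> space M - bad k"
    then show "\<forall>\<^sub>F k in sequentially. \<exists>n\<ge>1. (T ^^ n) x \<in> ball x0 ((1/2)^k) \<and>
      real n \<le> 4 * ((1/2)^k) powr - (real d + (2 * real d + 2) / p + 2 * \<epsilon>)"
    proof eventually_elim
      fix k assume k: "x \<in> space M - bad k"
      define r where "r = (1/2 :: real)^k"
      have r: "0 < r" "r \<le> 1" by (auto simp: r_def power_le_one)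
      obtain i where i: "1 \<le> i" "i \<le> K k" "(T ^^ (g k * i)) x \<in> ball x0 r"
        using k unfolding bad_def r_def by auto
      have one: "1 \<le> r powr - t" if "0 < t" for t
        using powr_mono2'[of "- t" r 1] r that by simp
      have "real (g k) \<le> 2 * r powr - a" "1 \<le> g k"
        using one[OF a] unfolding g_def r_def by linarith+
      moreover have "real (K k) \<le> 2 * r powr - (real d + \<epsilon>)"
        using one[of "real d + \<epsilon>"] \<epsilon> unfolding K_def r_def by linarith
      ultimately have "real (g k) * real (K k) \<le> (2 * r powr - a) * (2 * r powr - (real d + \<epsilon>))"
        by (intro mult_mono) auto
      also have "\<dots> = 4 * r powr - (real d + (2 * real d + 2) / p + 2 * \<epsilon>)"
      proof -
        have "- (real d + (2 * real d + 2) / p + 2 * \<epsilon>) = - a + - (real d + \<epsilon>)"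
          by (simp add: a_def)
        then show ?thesis by (simp only: powr_add)
      qed
      finally have "real (g k) * real (K k) \<le> 4 * r powr - (real d + (2 * real d + 2) / p + 2 * \<epsilon>)" .
      moreover have "real (g k * i) \<le> real (g k) * real (K k)"
        using i(2) by (simp add: mult_left_mono)
      ultimately have "real (g k * i) \<le> 4 * r powr - (real d + (2 * real d + 2) / p + 2 * \<epsilon>)"
        by linarith
      then show "\<exists>n\<ge>1. (T ^^ n) x \<in> ball x0 ((1/2)^k) \<and>
          real n \<le> 4 * ((1/2)^k) powr - (real d + (2 * real d + 2) / p + 2 * \<epsilon>)"
        using i \<open>1 \<le> g k\<close> unfolding r_def by (intro exI[of _ "g k * i"]) auto
    qed
  qed
qed

end

section \<open>The hitting exponent\<close>

text \<open>
  The exceptional null sets depend on \<open>\<epsilon>\<close>, so \<open>\<epsilon>\<close> runs through the countable family \<open>1 / (m + 1)\<close>.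
\<close>

lemma (in invariant_borel_system) AE_upper_hitting_exponent:
  assumes decay: "power_law_decay M T p" and "0 < p"
    and R: "0 < R" and c: "0 < c" and C: "0 \<le> C"
    and ball: "\<And>r. 0 < r \<Longrightarrow> r < R \<Longrightarrow> c * r ^ d \<le> prob (ball x0 r)"
      "\<And>r. 0 < r \<Longrightarrow> r < R \<Longrightarrow> prob (ball x0 r) \<le> C * r ^ d"
  shows "AE x in M. ereal (real d) \<le> upper_hitting_exponent T x x0 \<and>
    upper_hitting_exponent T x x0 \<le> ereal (real d + (2 * real d + 2) / p)"
proof -
  define D where "D = real d + (2 * real d + 2) / p"
  have D: "0 \<le> D" using \<open>0 < p\<close> by (simp add: D_def)
  define \<epsilon> where "\<epsilon> m = 1 / real (Suc m)" for m
  have \<epsilon>: "0 < \<epsilon> m" for m by (simp add: \<epsilon>_def)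
  have "AE x in M. ereal (real d - \<epsilon> m) \<le> upper_hitting_exponent T x x0 \<and>
      upper_hitting_exponent T x x0 \<le> ereal (D + 2 * \<epsilon> m)" for m
  proof -
    have "AE x in M. \<forall>\<^sub>F k in sequentially. \<forall>n\<ge>1. (T ^^ n) x \<in> ball x0 ((1/2)^k) \<longrightarrow>
        ((1/2)^k) powr - (real d - \<epsilon> m) < real n"
      by (rule AE_eventually_not_hit_early[OF R C _ \<epsilon>[of m]]) (rule ball(2))
    moreover have "AE x in M. \<forall>\<^sub>F k in sequentially. \<exists>n\<ge>1. (T ^^ n) x \<in> ball x0 ((1/2)^k) \<and>
        real n \<le> 4 * ((1/2)^k) powr - (D + 2 * \<epsilon> m)"
      unfolding D_def by (rule AE_eventually_hit_soon[OF decay \<open>0 < p\<close> R c _ \<epsilon>[of m]]) (rule ball(1))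
    ultimately show ?thesis
    proof eventually_elim
      case (elim x)
      then show ?case
        using upper_hitting_exponent_ge[OF elim(1)] upper_hitting_exponent_le[OF elim(2)] D \<epsilon>[of m]
        by simp
    qed
  qed
  then have "AE x in M. \<forall>m. ereal (real d - \<epsilon> m) \<le> upper_hitting_exponent T x x0 \<and>
      upper_hitting_exponent T x x0 \<le> ereal (D + 2 * \<epsilon> m)"
    by (subst AE_all_countable) blast
  then show ?thesis unfolding D_def[symmetric]
  proof eventually_elim
    case (elim x)
    have lim: "\<epsilon> \<longlonglongrightarrow> 0"
      unfolding \<epsilon>_def by (rule LIMSEQ_Suc[OF lim_1_over_n])
    have l: "(\<lambda>m. ereal (real d - \<epsilon> m)) \<longlonglongrightarrow> ereal (real d)"
      and u: "(\<lambda>m. ereal (D + 2 * \<epsilon> m)) \<longlonglongrightarrow> ereal D"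
      using lim by (auto intro!: tendsto_eq_intros)
    show ?case
      using LIMSEQ_le_const2[OF l] LIMSEQ_le_const[OF u] elim by simp
  qed
qed

theorem theoremC:
  fixes A :: "('a::{metric_space, second_countable_topology}, 'n::finite) chart set"
    and g :: "('a, 'n) chart \<Rightarrow> 'a \<Rightarrow> real ^ 'n ^ 'n"
    and vol M :: "'a measure"
    and T :: "'a \<Rightarrow> 'a"
    and \<rho> :: "'a \<Rightarrow> real"
    and p :: real
    and x0 :: 'a
  assumes "riemannian_manifold A g"
    and "is_riemannian_volume A g vol"
    and "T \<in> borel \<rightarrow>\<^sub>M borel"
    and "prob_space M"
    and "M = density vol (\<lambda>x. ennreal (\<rho> x))"
    and "continuous_on UNIV \<rho>"
    and "\<And>x. 0 < \<rho> x"
    and "distr M M T = M"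
    and "0 < p"
    and "power_law_decay M T p"
  shows "AE x in M.
           ereal (real CARD('n)) \<le> upper_hitting_exponent T x x0 \<and>
           upper_hitting_exponent T x x0
             \<le> ereal (real CARD('n) + (2 * real CARD('n) + 2) / p)"
proof -
  interpret prob_space M by (rule assms(4))
  have sets: "sets vol = sets borel"
    using assms(2) by (simp add: is_riemannian_volume_def)
  interpret invariant_borel_system M T
    by unfold_locales (simp_all add: assms(3,8) sets, simp add: assms(5) sets)
  obtain c C R where vol: "0 < c" "0 < C" "0 < R"
    "\<And>r. 0 < r \<Longrightarrow> r < R \<Longrightarrow> ennreal (c * r ^ CARD('n)) \<le> emeasure vol (ball x0 r)"
    "\<And>r. 0 < r \<Longrightarrow> r < R \<Longrightarrow> emeasure vol (ball x0 r) \<le> ennreal (C * r ^ CARD('n))"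
    by (rule riemannian_volume_ball_bounds[OF assms(1,2), of x0]) blast
  obtain c' C' R' where M: "0 < c'" "0 < C'" "0 < R'"
    "\<And>r. 0 < r \<Longrightarrow> r < R' \<Longrightarrow> c' * r ^ CARD('n) \<le> prob (ball x0 r)"
    "\<And>r. 0 < r \<Longrightarrow> r < R' \<Longrightarrow> prob (ball x0 r) \<le> C' * r ^ CARD('n)"
    by (rule density_ball_bounds[OF sets assms(5,4,6,7) vol]) blast+
  show ?thesis
    by (rule AE_upper_hitting_exponent[OF assms(10,9) M(3,1) less_imp_le[OF M(2)]])
      (rule M(4,5); assumption)+
qed

end
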